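(* There are absolute constants $c_3, c_4 > 0$ such that the following holds. For any $\delta \in (0,2)$, if $$2 + \log\left(1 + \frac{\|x^*\|_2^2}{\sigma^2}\right) \leq (2-\delta)\log n,$$ then $$\Pr\{\widehat{\Pi} \neq \Pi^*\} \geq 1 - c_3 e^{-c_4 n \delta}$$ for any estimator $\widehat{\Pi}$.
   Context: $\mathcal{P}_n$ denotes the set of $n\times n$ permutation matrices. The observation model is $y = \Pi^* A x^* + w$ with $n \geq d$, where $x^* \in \mathbb{R}^d$ is fixed but unknown, $A \in \mathbb{R}^{n \times d}$ has i.i.d. standard Gaussian entries (chosen without knowledge of $x^*$), $w \sim \mathcal{N}(0,\sigma^2 I_n)$ is the noise, and $\Pi^* \in \mathcal{P}_n$ is an unknown, arbitrary permutation matrix. An estimator of $\Pi^*$ is a map $\widehat{\Pi} : (y, A) \to \mathcal{P}_n$, and its risk is $\Pr\{\widehat{\Pi} \neq \Pi^*\} = \mathbb{E}[\mathbf{1}\{\widehat{\Pi} \neq \Pi^*\}]$, the probability being taken over the randomness in $y$ induced by both $A$ and $w$. Logarithms are natural. Absolute constants are independent of the other problem parameters. *)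

theory Defs
  imports "HOL-Probability.Probability" "Jordan_Normal_Form.Matrix"
begin

(* Vectors and matrices are those of Jordan_Normal_Form, because the dimensions n and d are
   quantified inside the statement. The competing HOL-Analysis notation is switched off. *)

unbundle no vec_syntax
unbundle no inner_syntax
hide_const (open) Finite_Cartesian_Product.vec Finite_Cartesian_Product.mat

definition perm_mats :: "nat \<Rightarrow> real mat set" where
  "perm_mats n = {P \<in> carrier_mat n n.
     (\<forall>i<n. \<forall>j<n. P $$ (i, j) \<in> {0, 1}) \<and>
     (\<forall>i<n. \<exists>!j. j < n \<and> P $$ (i, j) = 1) \<and>
     (\<forall>j<n. \<exists>!i. i < n \<and> P $$ (i, j) = 1)}"

(* The usual Borel sigma-algebras on R^n and R^(n x d), transported from the product
   sigma-algebras along the coordinate maps. *)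

definition borel_vec :: "nat \<Rightarrow> real vec measure" where
  "borel_vec n = vimage_algebra (carrier_vec n)
     (\<lambda>v. \<lambda>i\<in>{..<n}. v $ i) (\<Pi>\<^sub>M i\<in>{..<n}. borel)"

definition borel_mat :: "nat \<Rightarrow> nat \<Rightarrow> real mat measure" where
  "borel_mat n d = vimage_algebra (carrier_mat n d)
     (\<lambda>A. \<lambda>ij\<in>{..<n} \<times> {..<d}. A $$ ij) (\<Pi>\<^sub>M ij\<in>{..<n} \<times> {..<d}. borel)"

definition gaussian_vec :: "nat \<Rightarrow> real \<Rightarrow> real vec measure" where
  "gaussian_vec n \<sigma> =
     distr (\<Pi>\<^sub>M i\<in>{..<n}. density lborel (normal_density 0 \<sigma>)) (borel_vec n) (vec n)"

definition gaussian_mat :: "nat \<Rightarrow> nat \<Rightarrow> real mat measure" where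
  "gaussian_mat n d =
     distr (\<Pi>\<^sub>M ij\<in>{..<n} \<times> {..<d}. density lborel std_normal_density) (borel_mat n d) (mat n d)"

definition observation :: "real mat \<Rightarrow> real vec \<Rightarrow> real mat \<Rightarrow> real vec \<Rightarrow> real vec" where
  "observation P x A w = P *\<^sub>v (A *\<^sub>v x) + w"

(* An estimator may depend on n, d, sigma and even x; it is required to be measurable,
   since otherwise its error probability is not defined. *)

definition estimators :: "nat \<Rightarrow> nat \<Rightarrow> (real vec \<Rightarrow> real mat \<Rightarrow> real mat) set" where
  "estimators n d = {Phat.
     (\<lambda>(y, A). Phat y A) \<in> borel_vec n \<Otimes>\<^sub>M borel_mat n d \<rightarrow>\<^sub>M count_space (perm_mats n)}"

definition error_event ::
  "nat \<Rightarrow> nat \<Rightarrow> real \<Rightarrow> real vec \<Rightarrow> real mat \<Rightarrow> (real vec \<Rightarrow> real mat \<Rightarrow> real mat)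
     \<Rightarrow> (real mat \<times> real vec) set" where
  "error_event n d \<sigma> x P Phat =
     {(A, w) \<in> space (gaussian_mat n d \<Otimes>\<^sub>M gaussian_vec n \<sigma>).
        Phat (observation P x A w) A \<noteq> P}"

definition error_prob ::
  "nat \<Rightarrow> nat \<Rightarrow> real \<Rightarrow> real vec \<Rightarrow> real mat \<Rightarrow> (real vec \<Rightarrow> real mat \<Rightarrow> real mat) \<Rightarrow> real" where
  "error_prob n d \<sigma> x P Phat =
     measure (gaussian_mat n d \<Otimes>\<^sub>M gaussian_vec n \<sigma>) (error_event n d \<sigma> x P Phat)"

(* distr and measure are total, so the following facts are needed for the definitions
   above to have their intended meaning. *)

lemma space_borel_vec [simp]: "space (borel_vec n) = carrier_vec n"
  by (simp add: borel_vec_def)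

lemma space_borel_mat [simp]: "space (borel_mat n d) = carrier_mat n d"
  by (simp add: borel_mat_def)

lemma measurable_to_borel_vec:
  assumes "\<And>z. z \<in> space M \<Longrightarrow> f z \<in> carrier_vec n"
    and "\<And>i. i < n \<Longrightarrow> (\<lambda>z. f z $ i) \<in> borel_measurable M"
  shows "f \<in> M \<rightarrow>\<^sub>M borel_vec n"
  unfolding borel_vec_def
  by (rule measurable_vimage_algebra2) (use assms in \<open>auto intro!: measurable_restrict\<close>)

lemma measurable_to_borel_mat:
  assumes "\<And>z. z \<in> space M \<Longrightarrow> f z \<in> carrier_mat n d"
    and "\<And>i j. i < n \<Longrightarrow> j < d \<Longrightarrow> (\<lambda>z. f z $$ (i, j)) \<in> borel_measurable M"
  shows "f \<in> M \<rightarrow>\<^sub>M borel_mat n d"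
  unfolding borel_mat_def
  by (rule measurable_vimage_algebra2) (use assms in \<open>auto intro!: measurable_restrict\<close>)

lemma measurable_vec_entry:
  assumes "i < n"
  shows "(\<lambda>v. v $ i) \<in> borel_measurable (borel_vec n)"
proof -
  have 1: "(\<lambda>v. \<lambda>i\<in>{..<n}. v $ i) \<in> borel_vec n \<rightarrow>\<^sub>M (\<Pi>\<^sub>M i\<in>{..<n}. borel)"
    unfolding borel_vec_def by (rule measurable_vimage_algebra1) (auto simp: space_PiM)
  from measurable_compose[OF 1 measurable_component_singleton, of i] assms
  show ?thesis by simp
qed

lemma measurable_mat_entry:
  assumes "i < n" "j < d"
  shows "(\<lambda>A. A $$ (i, j)) \<in> borel_measurable (borel_mat n d)"
proof -
  have 1: "(\<lambda>A. \<lambda>ij\<in>{..<n} \<times> {..<d}. A $$ ij) \<in> borel_mat n d \<rightarrow>\<^sub>M (\<Pi>\<^sub>M ij\<in>{..<n} \<times> {..<d}. borel)"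
    unfolding borel_mat_def by (rule measurable_vimage_algebra1) (auto simp: space_PiM)
  from measurable_compose[OF 1 measurable_component_singleton, of "(i, j)"] assms
  show ?thesis by simp
qed

lemma prob_space_gaussian_vec:
  assumes "\<sigma> > 0"
  shows "prob_space (gaussian_vec n \<sigma>)"
  unfolding gaussian_vec_def
proof (rule prob_space.prob_space_distr)
  show "prob_space (\<Pi>\<^sub>M i\<in>{..<n}. density lborel (normal_density 0 \<sigma>))"
    by (intro prob_space_PiM prob_space_normal_density assms)
  show "vec n \<in> (\<Pi>\<^sub>M i\<in>{..<n}. density lborel (normal_density 0 \<sigma>)) \<rightarrow>\<^sub>M borel_vec n"
    proof (rule measurable_to_borel_vec)
    fix i assume "i < n"
    then have "(\<lambda>z. z i) \<in> (\<Pi>\<^sub>M i\<in>{..<n}. density lborel (normal_density 0 \<sigma>))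
        \<rightarrow>\<^sub>M density lborel (normal_density 0 \<sigma>)"
      by (intro measurable_component_singleton) simp
    with \<open>i < n\<close> show "(\<lambda>z. vec n z $ i)
        \<in> borel_measurable (\<Pi>\<^sub>M i\<in>{..<n}. density lborel (normal_density 0 \<sigma>))"
      by simp
  qed simp
qed

lemma prob_space_gaussian_mat: "prob_space (gaussian_mat n d)"
  unfolding gaussian_mat_def
proof (rule prob_space.prob_space_distr)
  show "prob_space (\<Pi>\<^sub>M ij\<in>{..<n} \<times> {..<d}. density lborel std_normal_density)"
    by (intro prob_space_PiM prob_space_normal_density) auto
  show "mat n d \<in> (\<Pi>\<^sub>M ij\<in>{..<n} \<times> {..<d}. density lborel std_normal_density) \<rightarrow>\<^sub>M borel_mat n d"
    proof (rule measurable_to_borel_mat)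
    fix i j assume "i < n" "j < d"
    then have "(\<lambda>z. z (i, j)) \<in> (\<Pi>\<^sub>M ij\<in>{..<n} \<times> {..<d}. density lborel std_normal_density)
        \<rightarrow>\<^sub>M density lborel std_normal_density"
      by (intro measurable_component_singleton) simp
    with \<open>i < n\<close> \<open>j < d\<close> show "(\<lambda>z. mat n d z $$ (i, j))
        \<in> borel_measurable (\<Pi>\<^sub>M ij\<in>{..<n} \<times> {..<d}. density lborel std_normal_density)"
      by simp
  qed simp
qed

lemma error_event_measurable:
  assumes x: "x \<in> carrier_vec d" and P: "P \<in> perm_mats n" and "Phat \<in> estimators n d"
  shows "error_event n d \<sigma> x P Phat \<in> sets (gaussian_mat n d \<Otimes>\<^sub>M gaussian_vec n \<sigma>)"
proof -
  let ?N = "borel_mat n d \<Otimes>\<^sub>M borel_vec n"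
  have sets_eq: "sets (gaussian_mat n d \<Otimes>\<^sub>M gaussian_vec n \<sigma>) = sets ?N"
    by (rule sets_pair_measure_cong) (simp_all add: gaussian_mat_def gaussian_vec_def)
  have Pc: "P \<in> carrier_mat n n" using P by (simp add: perm_mats_def)
  have entry: "(\<lambda>z. observation P x (fst z) (snd z) $ i) \<in> borel_measurable ?N" if i: "i < n" for i
  proof -
    have "(\<lambda>z. (\<Sum>k<n. P $$ (i, k) * (\<Sum>j<d. fst z $$ (k, j) * x $ j)) + snd z $ i)
        \<in> borel_measurable ?N"
      using i by (intro borel_measurable_add borel_measurable_sum borel_measurable_times
          borel_measurable_const measurable_compose[OF measurable_fst measurable_mat_entry]
          measurable_compose[OF measurable_snd measurable_vec_entry]) auto
    moreover have "observation P x (fst z) (snd z) $ i =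
        (\<Sum>k<n. P $$ (i, k) * (\<Sum>j<d. fst z $$ (k, j) * x $ j)) + snd z $ i"
      if "z \<in> space ?N" for z
      using that i x Pc
      by (auto simp: space_pair_measure observation_def scalar_prod_def atLeast0LessThan
          intro!: sum.cong)
    ultimately show ?thesis by (simp cong: measurable_cong)
  qed
  have obs: "(\<lambda>z. observation P x (fst z) (snd z)) \<in> ?N \<rightarrow>\<^sub>M borel_vec n"
    using entry x Pc
    by (intro measurable_to_borel_vec) (auto simp: observation_def space_pair_measure)
  have pair: "(\<lambda>z. (observation P x (fst z) (snd z), fst z)) \<in> ?N \<rightarrow>\<^sub>M borel_vec n \<Otimes>\<^sub>M borel_mat n d"
    by (intro measurable_Pair obs measurable_fst)
  have est0: "(\<lambda>(y, A). Phat y A) \<in> borel_vec n \<Otimes>\<^sub>M borel_mat n d \<rightarrow>\<^sub>M count_space (perm_mats n)"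
    using assms(3) by (simp add: estimators_def)
  have est: "(\<lambda>z. Phat (observation P x (fst z) (snd z)) (fst z))
      \<in> ?N \<rightarrow>\<^sub>M count_space (perm_mats n)"
    using measurable_compose[OF pair est0] by simp
  have "{z \<in> space ?N. Phat (observation P x (fst z) (snd z)) (fst z) \<noteq> P} =
      (\<lambda>z. Phat (observation P x (fst z) (snd z)) (fst z)) -` (perm_mats n - {P}) \<inter> space ?N"
    using measurable_space[OF est] by (simp only: space_count_space) blast
  also have "\<dots> \<in> sets ?N"
    by (rule measurable_sets[OF est]) simp
  finally have "{z \<in> space ?N. Phat (observation P x (fst z) (snd z)) (fst z) \<noteq> P} \<in> sets ?N" .
  moreover have "error_event n d \<sigma> x P Phat =
      {z \<in> space ?N. Phat (observation P x (fst z) (snd z)) (fst z) \<noteq> P}"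
    unfolding error_event_def sets_eq_imp_space_eq[OF sets_eq] by auto
  ultimately show ?thesis by (simp add: sets_eq)
qed

end

theory Submission
  imports Defs "HOL-Combinatorics.Multiset_Permutations"
begin

text \<open>
  Since \<open>\<delta> < 2\<close>, it suffices to bound the success probability, averaged over all permutations, by
  \<open>C exp (- c n)\<close>; the hypothesis is used only as \<open>|x| / \<sigma> \<le> n / e\<close>. Write \<open>A x = |x| t\<close> with
  \<open>t\<^sub>1, \<dots>, t\<^sub>n\<close> independent standard normal, and sort the \<open>t\<^sub>i\<close> into bins of width
  \<open>w = 1.1 sqrt (2 pi) / n\<close>, slightly more than the mean spacing of the \<open>t\<^sub>i\<close> at the origin.

  For fixed \<open>A\<close>, group the permutations by the pattern of bins they induce on the coordinates. Within
  one group every likelihood is dominated by a product of one-dimensional envelopes, the pointwise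
  suprema of the normal densities whose means share a bin. Such an envelope has integral at most
  \<open>b = 1 + 1.1 / e < sqrt 2\<close>, and exactly \<open>1\<close> if the bin holds a single point. The number of groups is
  a multinomial coefficient, so the average success probability is at most the product of
  \<open>b ^ k / k!\<close> over the bins with \<open>k \<ge> 2\<close> points. As \<open>b\<^sup>2 / 2 < 1\<close>, this decays exponentially in
  \<open>n\<close> minus the number of occupied bins.

  By the choice of \<open>w\<close> the interval \<open>[-1/2, 1/2]\<close> meets fewer bins, by a margin linear in \<open>n\<close>, than the
  expected number of \<open>t\<^sub>i\<close> in it; Hoeffding's inequality and the pigeonhole principle finish the proof.
\<close>


subsection \<open>Products of normal distributions\<close>

text \<open>Both sides agree on boxes by Tonelli. This puts the laws for all permutations on one
  reference measure, so that their likelihoods can be compared pointwise.\<close>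

lemma density_PiM_lborel:
  fixes f :: "'i \<Rightarrow> real \<Rightarrow> real"
  assumes I: "finite I"
    and meas [measurable]: "\<And>i. f i \<in> borel_measurable borel"
    and prob: "\<And>i. prob_space (density lborel (f i))"
  shows "density (PiM I (\<lambda>_. lborel)) (\<lambda>y. \<Prod>i\<in>I. ennreal (f i (y i))) = PiM I (\<lambda>i. density lborel (f i))"
proof -
  interpret L: product_sigma_finite "\<lambda>_. lborel :: real measure" by standard
  interpret D: product_sigma_finite "\<lambda>i. density lborel (f i)"
    by (intro product_sigma_finite.intro prob_space_imp_sigma_finite prob)
  show ?thesis
  proof (rule D.PiM_eqI[OF I])
    show "sets (density (PiM I (\<lambda>_. lborel)) (\<lambda>y. \<Prod>i\<in>I. ennreal (f i (y i)))) = sets (PiM I (\<lambda>i. density lborel (f i)))"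
      unfolding sets_density by (intro sets_PiM_cong) auto
    fix A assume A: "\<And>i. i \<in> I \<Longrightarrow> A i \<in> sets (density lborel (f i))"
    then have A' [measurable]: "\<And>i. i \<in> I \<Longrightarrow> A i \<in> sets borel" by simp
    have "emeasure (density (PiM I (\<lambda>_. lborel)) (\<lambda>y. \<Prod>i\<in>I. ennreal (f i (y i)))) (Pi\<^sub>E I A)
        = (\<integral>\<^sup>+y. (\<Prod>i\<in>I. ennreal (f i (y i))) * indicator (Pi\<^sub>E I A) y \<partial>PiM I (\<lambda>_. lborel))"
      using I A' by (subst emeasure_density) (auto intro!: sets_PiM_I_finite borel_measurable_prod)
    also have "\<dots> = (\<integral>\<^sup>+y. (\<Prod>i\<in>I. ennreal (f i (y i)) * indicator (A i) (y i)) \<partial>PiM I (\<lambda>_. lborel))"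
    proof (rule nn_integral_cong)
      \<comment> \<open>The indicator of a box factors into coordinate indicators only for
        extensional \<open>y\<close>; membership in the product space supplies that.\<close>
      fix y :: "'i \<Rightarrow> real" assume y: "y \<in> space (PiM I (\<lambda>_. lborel))"
      show "(\<Prod>i\<in>I. ennreal (f i (y i))) * indicator (Pi\<^sub>E I A) y
          = (\<Prod>i\<in>I. ennreal (f i (y i)) * indicator (A i) (y i))"
      proof (cases "y \<in> Pi\<^sub>E I A")
        case True
        then have "(\<Prod>i\<in>I. ennreal (f i (y i)) * indicator (A i) (y i)) = (\<Prod>i\<in>I. ennreal (f i (y i)))"
          by (intro prod.cong refl) (auto simp: PiE_iff)
        with True show ?thesis by simp
      next
        case False
        then obtain i where "i \<in> I" "y i \<notin> A i"
          using y by (auto simp: space_PiM PiE_iff)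
        with I have "(\<Prod>i\<in>I. ennreal (f i (y i)) * indicator (A i) (y i)) = 0"
          by (auto simp: prod_zero_iff indicator_def)
        with False show ?thesis by simp
      qed
    qed
    also have "\<dots> = (\<Prod>i\<in>I. \<integral>\<^sup>+y. ennreal (f i y) * indicator (A i) y \<partial>lborel)"
      using I A' by (intro L.product_nn_integral_prod) auto
    also have "\<dots> = (\<Prod>i\<in>I. emeasure (density lborel (f i)) (A i))"
      using A' by (intro prod.cong refl) (subst emeasure_density, auto)
    finally show "emeasure (density (PiM I (\<lambda>_. lborel)) (\<lambda>y. \<Prod>i\<in>I. ennreal (f i (y i)))) (Pi\<^sub>E I A)
        = (\<Prod>i\<in>I. emeasure (density lborel (f i)) (A i))" .
  qed
qed

lemma emeasure_normal_shift:
  assumes [measurable]: "A \<in> sets borel"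
  shows "emeasure (density lborel (normal_density 0 \<sigma>)) {z. m + z \<in> A} = emeasure (density lborel (normal_density m \<sigma>)) A"
proof -
  have "emeasure (density lborel (normal_density m \<sigma>)) A
      = (\<integral>\<^sup>+y. ennreal (normal_density m \<sigma> y) * indicator A y \<partial>lborel)"
    by (subst emeasure_density) auto
  also have "\<dots> = (\<integral>\<^sup>+z. ennreal (normal_density m \<sigma> (m + z)) * indicator A (m + z) \<partial>lborel)"
    by (subst nn_integral_real_affine[where c = 1 and t = m]) auto
  also have "\<dots> = (\<integral>\<^sup>+z. ennreal (normal_density 0 \<sigma> z) * indicator {z. m + z \<in> A} z \<partial>lborel)"
    by (intro nn_integral_cong) (auto simp: normal_density_def indicator_def)
  also have "\<dots> = emeasure (density lborel (normal_density 0 \<sigma>)) {z. m + z \<in> A}"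
    by (subst emeasure_density) auto
  finally show ?thesis by simp
qed

text \<open>Given the design, the observation is the noise translated by fixed means; this
  identifies its conditional law.\<close>

lemma distr_PiM_normal_shift:
  fixes m :: "'i \<Rightarrow> real" and \<sigma> :: real
  assumes I: "finite I" and \<sigma>: "\<sigma> > 0"
  shows "distr (PiM I (\<lambda>_. density lborel (normal_density 0 \<sigma>))) (PiM I (\<lambda>_. borel)) (\<lambda>z. \<lambda>i\<in>I. m i + z i)
    = PiM I (\<lambda>i. density lborel (normal_density (m i) \<sigma>))" (is "distr ?N _ ?T = _")
proof -
  interpret N: product_sigma_finite "\<lambda>_. density lborel (normal_density 0 \<sigma>)"
    by (intro product_sigma_finite.intro prob_space_imp_sigma_finite prob_space_normal_density \<sigma>)
  interpret D: product_sigma_finite "\<lambda>i. density lborel (normal_density (m i) \<sigma>)"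
    by (intro product_sigma_finite.intro prob_space_imp_sigma_finite prob_space_normal_density \<sigma>)
  have sN: "sets ?N = sets (PiM I (\<lambda>_. borel))"
    by (intro sets_PiM_cong) auto
  have T: "?T \<in> ?N \<rightarrow>\<^sub>M PiM I (\<lambda>_. borel)"
    unfolding measurable_cong_sets[OF sN refl] by (intro measurable_restrict) measurable
  show ?thesis
  proof (rule D.PiM_eqI[OF I])
    show "sets (distr ?N (PiM I (\<lambda>_. borel)) ?T) = sets (PiM I (\<lambda>i. density lborel (normal_density (m i) \<sigma>)))"
      unfolding sets_distr by (intro sets_PiM_cong) auto
    fix A assume A: "\<And>i. i \<in> I \<Longrightarrow> A i \<in> sets (density lborel (normal_density (m i) \<sigma>))"
    then have A' [measurable]: "\<And>i. i \<in> I \<Longrightarrow> A i \<in> sets borel" by simp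
    have "emeasure (distr ?N (PiM I (\<lambda>_. borel)) ?T) (Pi\<^sub>E I A) = emeasure ?N (?T -` Pi\<^sub>E I A \<inter> space ?N)"
      using I A' by (intro emeasure_distr T sets_PiM_I_finite) auto
    also have "?T -` Pi\<^sub>E I A \<inter> space ?N = Pi\<^sub>E I (\<lambda>i. {z. m i + z \<in> A i})"
      by (auto simp: space_PiM PiE_iff)
    also have "emeasure ?N \<dots> = (\<Prod>i\<in>I. emeasure (density lborel (normal_density 0 \<sigma>)) {z. m i + z \<in> A i})"
      using I by (intro N.emeasure_PiM) (auto intro!: measurable_sets_borel)
    also have "\<dots> = (\<Prod>i\<in>I. emeasure (density lborel (normal_density (m i) \<sigma>)) (A i))"
      by (intro prod.cong refl emeasure_normal_shift) auto
    finally show "emeasure (distr ?N (PiM I (\<lambda>_. borel)) ?T) (Pi\<^sub>E I A)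
      = (\<Prod>i\<in>I. emeasure (density lborel (normal_density (m i) \<sigma>)) (A i))" .
  qed
qed

subsection \<open>Envelopes of normal densities\<close>

text \<open>For \<open>l\<close> \<le> \<open>u\<close> and positive \<sigma>, this is the supremum
  at \<open>y\<close> of the normal densities with mean in \<open>[l, u]\<close>. The plateau is the
  common peak height, attained by the density centred at \<open>y\<close>.\<close>

definition gauss_envelope :: "real \<Rightarrow> real \<Rightarrow> real \<Rightarrow> real \<Rightarrow> real" where
  "gauss_envelope \<sigma> l u y = (if y < l then normal_density l \<sigma> y
     else if y \<le> u then 1 / (\<sigma> * sqrt (2 * pi)) else normal_density u \<sigma> y)"

lemma gauss_envelope_measurable [measurable]: "gauss_envelope \<sigma> l u \<in> borel_measurable borel"
  unfolding gauss_envelope_def by measurable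

text \<open>A normal density at \<open>y\<close> decreases with the distance from \<open>y\<close>
  to the mean, and the point of \<open>[l, u]\<close> nearest to \<open>y\<close> is
  \<open>l\<close>, \<open>y\<close> or \<open>u\<close>.\<close>

lemma normal_density_le_gauss_envelope:
  assumes \<sigma>: "\<sigma> > 0" and m: "l \<le> m" "m \<le> u"
  shows "normal_density m \<sigma> y \<le> gauss_envelope \<sigma> l u y"
proof -
  have mono: "normal_density m \<sigma> y \<le> normal_density m' \<sigma> y" if "(y - m')\<^sup>2 \<le> (y - m)\<^sup>2" for m'
    using that \<sigma> by (auto simp: normal_density_def intro!: divide_right_mono)
  consider "y < l" | "l \<le> y" "y \<le> u" | "l \<le> y" "u < y" by linarith
  then show ?thesis
  proof cases
    case 1
    then have "(y - l)\<^sup>2 \<le> (y - m)\<^sup>2" using m by (simp add: abs_le_square_iff[symmetric])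
    with mono 1 show ?thesis by (simp add: gauss_envelope_def)
  next
    case 2
    have "normal_density m \<sigma> y \<le> normal_density y \<sigma> y" by (rule mono) simp
    also have "\<dots> = 1 / (\<sigma> * sqrt (2 * pi))"
      using \<sigma> by (simp add: normal_density_def real_sqrt_mult)
    finally show ?thesis using 2 by (simp add: gauss_envelope_def)
  next
    case 3
    then have "(y - u)\<^sup>2 \<le> (y - m)\<^sup>2" using m by (simp add: abs_le_square_iff[symmetric])
    with mono 3 show ?thesis by (simp add: gauss_envelope_def)
  qed
qed

lemma nn_integral_normal_density:
  assumes "\<sigma> > 0"
  shows "(\<integral>\<^sup>+y. normal_density m \<sigma> y \<partial>lborel) = 1"
  using prob_space.emeasure_space_1[OF prob_space_normal_density[OF assms, of m]]
  by (simp add: emeasure_density)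

text \<open>Translated to the origin, the two tails are the two halves of one normal density and
  have total mass at most 1. The plateau adds its width times the peak height.\<close>

lemma nn_integral_gauss_envelope:
  assumes \<sigma>: "\<sigma> > 0" and lu: "l \<le> u"
  shows "(\<integral>\<^sup>+y. gauss_envelope \<sigma> l u y \<partial>lborel) \<le> ennreal (1 + (u - l) / (\<sigma> * sqrt (2 * pi)))"
proof -
  let ?c = "1 / (\<sigma> * sqrt (2 * pi))"
  let ?g = "\<lambda>y. ennreal (normal_density 0 \<sigma> y)"
  have c: "?c \<ge> 0" using \<sigma> by simp
  have "(\<integral>\<^sup>+y. gauss_envelope \<sigma> l u y \<partial>lborel) =
     (\<integral>\<^sup>+y. ?g (y - l) * indicator {..<0} (y - l) + (ennreal ?c * indicator {l..u} y
         + ?g (y - u) * indicator {0<..} (y - u)) \<partial>lborel)"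
    using lu by (intro nn_integral_cong) (auto simp: gauss_envelope_def normal_density_def indicator_def)
  also have "\<dots> = (\<integral>\<^sup>+y. ?g (y - l) * indicator {..<0} (y - l) \<partial>lborel) + ((\<integral>\<^sup>+y. ennreal ?c * indicator {l..u} y \<partial>lborel)
         + (\<integral>\<^sup>+y. ?g (y - u) * indicator {0<..} (y - u) \<partial>lborel))"
    by (subst nn_integral_add; (subst nn_integral_add)?) auto
  also have "(\<integral>\<^sup>+y. ?g (y - l) * indicator {..<0} (y - l) \<partial>lborel) = (\<integral>\<^sup>+y. ?g y * indicator {..<0} y \<partial>lborel)"
    by (subst nn_integral_real_affine[where c = 1 and t = l]) auto
  also have "(\<integral>\<^sup>+y. ?g (y - u) * indicator {0<..} (y - u) \<partial>lborel) = (\<integral>\<^sup>+y. ?g y * indicator {0<..} y \<partial>lborel)"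
    by (subst nn_integral_real_affine[where c = 1 and t = u]) auto
  also have "(\<integral>\<^sup>+y. ennreal ?c * indicator {l..u} y \<partial>lborel) = ennreal (?c * (u - l))"
    using lu c by (subst nn_integral_cmult_indicator) (simp_all add: ennreal_mult[symmetric] del: times_divide_eq_left)
  also have "(\<integral>\<^sup>+y. ?g y * indicator {..<0} y \<partial>lborel) + (ennreal (?c * (u - l)) + (\<integral>\<^sup>+y. ?g y * indicator {0<..} y \<partial>lborel))
      = ennreal (?c * (u - l)) + ((\<integral>\<^sup>+y. ?g y * indicator {..<0} y \<partial>lborel) + (\<integral>\<^sup>+y. ?g y * indicator {0<..} y \<partial>lborel))"
    by (simp add: ac_simps)
  also have "(\<integral>\<^sup>+y. ?g y * indicator {..<0} y \<partial>lborel) + (\<integral>\<^sup>+y. ?g y * indicator {0<..} y \<partial>lborel)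
     = (\<integral>\<^sup>+y. ?g y * indicator {..<0} y + ?g y * indicator {0<..} y \<partial>lborel)"
    by (subst nn_integral_add) auto
  also have "\<dots> \<le> (\<integral>\<^sup>+y. ?g y \<partial>lborel)"
    by (intro nn_integral_mono) (auto simp: indicator_def)
  also have "\<dots> = 1" by (rule nn_integral_normal_density[OF \<sigma>])
  also have "ennreal (?c * (u - l)) + 1 = ennreal (1 + (u - l) / (\<sigma> * sqrt (2 * pi)))"
    using c lu \<sigma> by (subst ennreal_1[symmetric], subst ennreal_plus[symmetric]) (auto simp: add.commute)
  finally show ?thesis by simp
qed


subsection \<open>Grouping permutations by label patterns\<close>

lemma prod_nth_eq_prod_mset:
  fixes g :: "'l \<Rightarrow> 'b::comm_monoid_mult"
  shows "(\<Prod>i<length xs. g (xs ! i)) = prod_mset (image_mset g (mset xs))"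
proof -
  have "(\<Prod>i<length xs. g (xs ! i)) = prod_list (map g xs)"
    by (simp add: prod.list_conv_set_nth atLeast0LessThan)
  also have "\<dots> = prod_mset (image_mset g (mset xs))"
    by (metis mset_map prod_mset_prod_list)
  finally show ?thesis .
qed

text \<open>The events are disjoint, so at each \<open>y\<close> at most one permutation
  contributes, and its likelihood is dominated by the envelope product of the label word it induces.
  Summing these products over words counts distinct words instead of permutations.\<close>

lemma sum_emeasure_permuted_le:
  fixes a :: "nat \<Rightarrow> real" and lab :: "nat \<Rightarrow> 'l" and \<sigma> :: real
  assumes \<sigma>: "\<sigma> > 0"
    and psi_meas [measurable]: "\<And>l. psi l \<in> borel_measurable borel"
    and psi: "\<And>j y. j < n \<Longrightarrow> normal_density (a j) \<sigma> y \<le> psi (lab j) y"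
    and beta: "\<And>j. j < n \<Longrightarrow> (\<integral>\<^sup>+y. ennreal (psi (lab j) y) \<partial>lborel) \<le> ennreal (\<beta> (lab j))"
    and beta_nonneg: "\<And>j. j < n \<Longrightarrow> 0 \<le> \<beta> (lab j)"
    and E: "\<And>\<pi>. \<pi> permutes {..<n} \<Longrightarrow> E \<pi> \<in> sets (PiM {..<n} (\<lambda>_. borel))"
    and disj: "disjoint_family_on E {\<pi>. \<pi> permutes {..<n}}"
  shows "(\<Sum>\<pi> | \<pi> permutes {..<n}.
            emeasure (PiM {..<n} (\<lambda>i. density lborel (normal_density (a (\<pi> i)) \<sigma>))) (E \<pi>))
         \<le> ennreal (real (card (permutations_of_multiset (mset (map lab [0..<n])))) * (\<Prod>j<n. \<beta> (lab j)))"
proof -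
  interpret L: product_sigma_finite "\<lambda>_. lborel :: real measure" by standard
  let ?L = "PiM {..<n} (\<lambda>_. lborel :: real measure)"
  let ?S = "{\<pi>. \<pi> permutes {..<n}}"
  define Ls where "Ls = permutations_of_multiset (mset (map lab [0..<n]))"
  define f where "f \<pi> y = (\<Prod>i<n. ennreal (normal_density (a (\<pi> i)) \<sigma> (y i)))" for \<pi> y
  define g where "g xs y = (\<Prod>i<n. ennreal (psi (xs ! i) (y i)))" for xs and y :: "nat \<Rightarrow> real"
  have sets_L: "sets ?L = sets (PiM {..<n} (\<lambda>_. borel))" by (intro sets_PiM_cong) auto
  have finS: "finite ?S" by (simp add: finite_permutations)
  have finLs: "finite Ls" by (simp add: Ls_def)
  have len: "length xs = n" if "xs \<in> Ls" for xs
    using that by (auto simp: Ls_def permutations_of_multiset_def dest: arg_cong[of _ _ size])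
  have f_meas [measurable]: "f \<pi> \<in> borel_measurable ?L" for \<pi>
    unfolding f_def by (intro borel_measurable_prod_ennreal) measurable
  have g_meas [measurable]: "g xs \<in> borel_measurable ?L" for xs
    unfolding g_def by (intro borel_measurable_prod_ennreal) measurable
  have E': "E \<pi> \<in> sets ?L" if "\<pi> \<in> ?S" for \<pi>
    using that E sets_L by simp
  have emeasure_E: "emeasure (PiM {..<n} (\<lambda>i. density lborel (normal_density (a (\<pi> i)) \<sigma>))) (E \<pi>)
      = (\<integral>\<^sup>+y. f \<pi> y * indicator (E \<pi>) y \<partial>?L)" if "\<pi> \<in> ?S" for \<pi>
  proof -
    have "PiM {..<n} (\<lambda>i. density lborel (normal_density (a (\<pi> i)) \<sigma>)) = density ?L (f \<pi>)"
      unfolding f_def by (intro density_PiM_lborel[symmetric] prob_space_normal_density \<sigma>) auto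
    then show ?thesis using E'[OF that] by (simp add: emeasure_density)
  qed
  have dom: "(\<Sum>\<pi>\<in>?S. f \<pi> y * indicator (E \<pi>) y) \<le> (\<Sum>xs\<in>Ls. g xs y)" for y
  proof (cases "\<exists>\<pi>\<in>?S. y \<in> E \<pi>")
    case True
    then obtain \<pi> where \<pi>: "\<pi> permutes {..<n}" "y \<in> E \<pi>" by auto
    define xs where "xs = map (\<lambda>i. lab (\<pi> i)) [0..<n]"
    have "y \<notin> E \<pi>'" if "\<pi>' \<in> ?S - {\<pi>}" for \<pi>'
      using that \<pi> disj unfolding disjoint_family_on_def by blast
    then have "(\<Sum>\<pi>\<in>?S. f \<pi> y * indicator (E \<pi>) y) = f \<pi> y"
      using \<pi> finS by (subst sum.remove[of _ \<pi>]) auto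
    also have "f \<pi> y \<le> g xs y"
      unfolding f_def g_def
    proof (intro prod_mono_ennreal)
      fix i assume i: "i \<in> {..<n}"
      then have "\<pi> i < n" using \<pi>(1) permutes_in_image by fastforce
      with i psi show "ennreal (normal_density (a (\<pi> i)) \<sigma> (y i)) \<le> ennreal (psi (xs ! i) (y i))"
        by (auto simp: xs_def intro!: ennreal_leI)
    qed
    also have "xs \<in> Ls"
    proof -
      \<comment> \<open>A permutation only reorders the indices, so the word it induces has the same
        multiset of labels as the identity.\<close>
      have "mset xs = image_mset lab (image_mset \<pi> (mset_set {..<n}))"
        by (simp add: xs_def multiset.map_comp comp_def atLeast0LessThan)
      also have "image_mset \<pi> (mset_set {..<n}) = mset_set {..<n}"
        by (subst image_mset_mset_set) (simp_all add: permutes_image[OF \<pi>(1)] inj_on_subset[OF permutes_inj[OF \<pi>(1)]])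
      finally show ?thesis by (simp add: Ls_def permutations_of_multiset_def atLeast0LessThan)
    qed
    \<comment> \<open>The word depends on \<open>y\<close> through the permutation; bounding its
      term by the sum over all words removes this dependence.\<close>
    then have "g xs y \<le> (\<Sum>xs\<in>Ls. g xs y)"
      using finLs by (intro member_le_sum) auto
    finally show ?thesis .
  next
    case False
    then show ?thesis by (simp add: sum.neutral)
  qed
  have int_g: "(\<integral>\<^sup>+y. g xs y \<partial>?L) \<le> ennreal (\<Prod>j<n. \<beta> (lab j))" if xs: "xs \<in> Ls" for xs
  proof -
    let ?J = "\<lambda>l. \<integral>\<^sup>+y. ennreal (psi l y) \<partial>lborel"
    have "(\<integral>\<^sup>+y. g xs y \<partial>?L) = (\<Prod>i<n. ?J (xs ! i))"
      unfolding g_def by (intro L.product_nn_integral_prod) auto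
    also have "\<dots> = prod_mset (image_mset ?J (mset xs))"
      using prod_nth_eq_prod_mset[of ?J xs] len[OF xs] by simp
    \<comment> \<open>The integral depends only on the multiset of letters, hence is the same
      product for every word.\<close>
    also have "mset xs = mset (map lab [0..<n])"
      using xs by (simp add: Ls_def permutations_of_multiset_def)
    also have "prod_mset (image_mset ?J \<dots>) = (\<Prod>j<n. ?J (lab j))"
      by (subst prod_nth_eq_prod_mset[symmetric]) simp
    also have "\<dots> \<le> (\<Prod>j<n. ennreal (\<beta> (lab j)))"
      by (intro prod_mono_ennreal beta) simp
    also have "\<dots> = ennreal (\<Prod>j<n. \<beta> (lab j))"
      by (intro prod_ennreal beta_nonneg) simp
    finally show ?thesis .
  qed
  have "(\<Sum>\<pi>\<in>?S. emeasure (PiM {..<n} (\<lambda>i. density lborel (normal_density (a (\<pi> i)) \<sigma>))) (E \<pi>))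
      = (\<Sum>\<pi>\<in>?S. \<integral>\<^sup>+y. f \<pi> y * indicator (E \<pi>) y \<partial>?L)"
    by (intro sum.cong refl emeasure_E)
  also have "\<dots> = (\<integral>\<^sup>+y. (\<Sum>\<pi>\<in>?S. f \<pi> y * indicator (E \<pi>) y) \<partial>?L)"
    using E' by (intro nn_integral_sum[symmetric]) auto
  also have "\<dots> \<le> (\<integral>\<^sup>+y. (\<Sum>xs\<in>Ls. g xs y) \<partial>?L)"
    by (intro nn_integral_mono dom)
  also have "\<dots> = (\<Sum>xs\<in>Ls. \<integral>\<^sup>+y. g xs y \<partial>?L)"
    by (intro nn_integral_sum) auto
  also have "\<dots> \<le> (\<Sum>xs\<in>Ls. ennreal (\<Prod>j<n. \<beta> (lab j)))"
    by (intro sum_mono int_g)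
  also have "\<dots> = ennreal (real (card Ls) * (\<Prod>j<n. \<beta> (lab j)))"
    by (subst ennreal_mult) (auto intro!: prod_nonneg beta_nonneg simp: ennreal_of_nat_eq_real_of_nat)
  finally show ?thesis by (simp only: Ls_def)
qed

text \<open>With \<open>k l\<close> indices of label \<open>l\<close>, the number of words is
  \<open>n!\<close> divided by the product of the \<open>k l\<close> factorials. The hypothesis on
  \<open>\<beta>\<close> cancels these factorials and leaves \<open>\<rho>\<close> to the sum of
  \<open>k l - 1\<close>, which is \<open>n\<close> minus the number of labels in use.\<close>

lemma card_permutations_of_multiset_prod_le:
  fixes lab :: "nat \<Rightarrow> 'l" and \<beta> :: "'l \<Rightarrow> real"
  assumes \<rho>: "\<rho> \<ge> 0" and beta_nonneg: "\<And>l. l \<in> lab ` {..<n} \<Longrightarrow> 0 \<le> \<beta> l"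
    and beta: "\<And>l. l \<in> lab ` {..<n} \<Longrightarrow>
       \<beta> l ^ card {j \<in> {..<n}. lab j = l} \<le> \<rho> ^ (card {j \<in> {..<n}. lab j = l} - 1) * fact (card {j \<in> {..<n}. lab j = l})"
  shows "real (card (permutations_of_multiset (mset (map lab [0..<n])))) * (\<Prod>j<n. \<beta> (lab j))
     \<le> fact n * \<rho> ^ (n - card (lab ` {..<n}))"
proof -
  define B where "B = lab ` {..<n}"
  define k where "k l = card {j \<in> {..<n}. lab j = l}" for l
  define M where "M = mset (map lab [0..<n])"
  have finB: "finite B" by (simp add: B_def)
  have k_pos: "k l \<ge> 1" if "l \<in> B" for l
    using that by (auto simp: B_def k_def Suc_le_eq card_gt_0_iff)
  have sum_k: "(\<Sum>l\<in>B. k l) = n"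
    using sum.image_gen[of "{..<n}" "\<lambda>_. 1::nat" lab] by (simp add: B_def k_def)
  have count: "count M l = k l" for l
    by (simp add: M_def k_def count_image_mset count_mset_set' atLeast0LessThan
        flip: mset_set_upto_eq_mset_upto) (rule arg_cong[of _ _ card], auto)
  have set_M: "set_mset M = B" by (auto simp: M_def B_def)
  have "(\<Prod>j<n. \<beta> (lab j)) = (\<Prod>l\<in>B. \<beta> l ^ k l)"
    by (subst prod.image_gen[of _ _ lab]) (auto simp: B_def k_def intro!: prod.cong)
  also have "\<dots> \<le> (\<Prod>l\<in>B. \<rho> ^ (k l - 1) * fact (k l))"
    using beta beta_nonneg by (intro prod_mono) (auto simp: B_def k_def)
  also have "\<dots> = \<rho> ^ (\<Sum>l\<in>B. k l - 1) * (\<Prod>l\<in>B. fact (k l))"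
    by (simp add: prod.distrib power_sum)
  also have "(\<Sum>l\<in>B. k l - 1) = n - card B"
    using k_pos sum_k by (subst sum_subtractf_nat) auto
  finally have "real (card (permutations_of_multiset M)) * (\<Prod>j<n. \<beta> (lab j))
      \<le> real (card (permutations_of_multiset M)) * (\<rho> ^ (n - card B) * (\<Prod>l\<in>B. fact (k l)))"
    by (intro mult_left_mono) auto
  also have "\<dots> = \<rho> ^ (n - card B) * real (card (permutations_of_multiset M) * (\<Prod>l\<in>set_mset M. fact (count M l)))"
    by (simp add: set_M count)
  also have "\<dots> = fact n * \<rho> ^ (n - card B)"
    by (subst card_permutations_of_multiset_aux) (simp add: M_def)
  finally show ?thesis by (simp add: M_def B_def)
qed


subsection \<open>Concentration of the central rows\<close>

text \<open>The joint law of the coordinates is the product measure itself, which is the product of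
  their marginals.\<close>

lemma indep_vars_PiM_coordinates:
  assumes I: "I \<noteq> {}" and prob: "\<And>i. i \<in> I \<Longrightarrow> prob_space (M i)"
  shows "prob_space.indep_vars (PiM I M) M (\<lambda>i \<omega>. \<omega> i) I"
proof -
  interpret P: prob_space "PiM I M" by (rule prob_space_PiM) (rule prob)
  have "distr (PiM I M) (PiM I M) (\<lambda>x. \<lambda>i\<in>I. x i) = distr (PiM I M) (PiM I M) (\<lambda>x. x)"
    by (intro distr_cong) (auto simp: space_PiM)
  also have "\<dots> = PiM I M" by simp
  also have "\<dots> = PiM I (\<lambda>i. distr (PiM I M) (M i) (\<lambda>x. x i))"
    by (intro PiM_cong refl distr_PiM_component[symmetric]) (auto intro: prob)
  finally show ?thesis
    using I by (subst P.indep_vars_iff_distr_eq_PiM') auto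
qed

text \<open>\<open>T i\<close> is the inner product of row \<open>i\<close> with a unit vector.
  Different rows use disjoint sets of entries, whence independence; the variances
  \<open>(u j)^2\<close> of the independent summands add up to 1.\<close>

lemma std_normal_row_combinations:
  fixes u :: "nat \<Rightarrow> real" and n d :: nat
  defines "G \<equiv> PiM ({..<n} \<times> {..<d}) (\<lambda>_. density lborel std_normal_density)"
    and "T \<equiv> (\<lambda>i (\<omega> :: nat \<times> nat \<Rightarrow> real). \<Sum>j<d. \<omega> (i, j) * u j)"
  assumes u: "(\<Sum>j<d. (u j)\<^sup>2) = 1" and n: "0 < n"
  shows "prob_space.indep_vars G (\<lambda>_. borel) T {..<n}"
    and "\<And>i. i < n \<Longrightarrow> distributed G lborel (T i) std_normal_density"
proof -
  let ?I = "{..<n} \<times> {..<d}" and ?N = "density lborel (\<lambda>x. ennreal (std_normal_density x))"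
  have prob_N: "prob_space ?N" by (rule prob_space_normal_density) simp
  interpret G: prob_space G unfolding G_def by (rule prob_space_PiM) (rule prob_N)
  have "d \<noteq> 0" using u by (intro notI) simp
  then have "?I \<noteq> {}" using n by (auto simp: lessThan_empty_iff)
  then have coord: "G.indep_vars (\<lambda>_. ?N) (\<lambda>p \<omega>. \<omega> p) ?I"
    unfolding G_def by (intro indep_vars_PiM_coordinates prob_N)
  then have coord_borel: "G.indep_vars (\<lambda>_. borel) (\<lambda>p \<omega>. \<omega> p) ?I"
    by (rule G.indep_vars_compose2[where Y = "\<lambda>_ y. y"]) auto
  have "G.indep_vars (\<lambda>i. PiM ({i} \<times> {..<d}) (\<lambda>_. ?N)) (\<lambda>i \<omega>. restrict (\<lambda>p. \<omega> p) ({i} \<times> {..<d})) {..<n}"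
    by (rule G.indep_vars_restrict[OF coord]) (auto simp: disjoint_family_on_def)
  then have "G.indep_vars (\<lambda>_. borel) (\<lambda>i \<omega>. T i (restrict (\<lambda>p. \<omega> p) ({i} \<times> {..<d}))) {..<n}"
  proof (rule G.indep_vars_compose2)
    fix i assume "i \<in> {..<n}"
    have "(\<lambda>\<omega>. \<omega> (i, j)) \<in> borel_measurable (PiM ({i} \<times> {..<d}) (\<lambda>_. ?N))" if "j < d" for j
      using measurable_component_singleton[of "(i, j)" "{i} \<times> {..<d}" "\<lambda>_. ?N"] that by simp
    then show "T i \<in> borel_measurable (PiM ({i} \<times> {..<d}) (\<lambda>_. ?N))"
      unfolding T_def by (intro borel_measurable_sum borel_measurable_times) auto
  qed
  moreover have "T i (restrict (\<lambda>p. \<omega> p) ({i} \<times> {..<d})) = T i \<omega>" for i \<omega>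
    by (simp add: T_def)
  ultimately show "G.indep_vars (\<lambda>_. borel) T {..<n}" by (simp add: restrict_def[symmetric])
  fix i assume i: "i < n"
  \<comment> \<open>\<open>sum_indep_normal\<close> requires positive variances.\<close>
  define J where "J = {j. j < d \<and> u j \<noteq> 0}"
  have finJ: "finite J" by (simp add: J_def)
  have sumJ: "(\<Sum>j\<in>J. (u j)\<^sup>2) = 1"
    unfolding u[symmetric] J_def by (intro sum.mono_neutral_left) auto
  then have J: "J \<noteq> {}" by auto
  have indJ: "G.indep_vars (\<lambda>_. borel) (\<lambda>j \<omega>. \<omega> (i, j) * u j) J"
  proof -
    have "G.indep_vars (\<lambda>j. PiM {(i, j)} (\<lambda>_. borel)) (\<lambda>j \<omega>. restrict (\<lambda>p. \<omega> p) {(i, j)}) J"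
      using i by (intro G.indep_vars_restrict[OF coord_borel]) (auto simp: J_def disjoint_family_on_def)
    then have "G.indep_vars (\<lambda>_. borel) (\<lambda>j \<omega>. restrict (\<lambda>p. \<omega> p) {(i, j)} (i, j) * u j) J"
      by (rule G.indep_vars_compose2[where Y = "\<lambda>j f. f (i, j) * u j"])
         (auto intro!: borel_measurable_times measurable_component_singleton)
    then show ?thesis by simp
  qed
  have distr_coord: "distributed G lborel (\<lambda>\<omega>. \<omega> (i, j)) std_normal_density" if "j < d" for j
  proof -
    have "distr G lborel (\<lambda>\<omega>. \<omega> (i, j)) = distr G ?N (\<lambda>\<omega>. \<omega> (i, j))"
      by (intro distr_cong) auto
    also have "\<dots> = ?N"
      unfolding G_def using i that prob_N by (intro distr_PiM_component) auto
    finally show ?thesis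
      using measurable_component_singleton[of "(i, j)" ?I "\<lambda>_. ?N"] i that
      by (auto simp: distributed_def G_def)
  qed
  have "distributed G lborel (\<lambda>\<omega>. \<Sum>j\<in>J. \<omega> (i, j) * u j)
     (normal_density (\<Sum>j\<in>J. 0) (sqrt (\<Sum>j\<in>J. \<bar>u j\<bar>\<^sup>2)))"
  proof (rule G.sum_indep_normal[OF finJ J indJ])
    fix j assume j: "j \<in> J"
    then show "0 < \<bar>u j\<bar>" by (simp add: J_def)
    show "distributed G lborel (\<lambda>\<omega>. \<omega> (i, j) * u j) (normal_density 0 \<bar>u j\<bar>)"
      using G.normal_density_affine[OF distr_coord, of j "u j" 0] j
      by (simp add: J_def mult.commute)
  qed
  moreover have "(\<Sum>j\<in>J. \<omega> (i, j) * u j) = T i \<omega>" for \<omega> :: "nat \<times> nat \<Rightarrow> real"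
    unfolding T_def J_def by (intro sum.mono_neutral_left) auto
  ultimately show "distributed G lborel (T i) std_normal_density" by (simp add: sumJ)
qed

text \<open>Integrate \<open>1 - x^2/2\<close>, a lower bound for \<open>exp (- x^2/2)\<close>, over
  the interval: this gives \<open>1 - 1/24\<close>.\<close>

lemma std_normal_central_mass:
  "measure (density lborel std_normal_density) {-(1/2)..1/2} \<ge> 23/24 / sqrt (2 * pi)"
proof -
  let ?c = "1 / sqrt (2 * pi)"
  let ?F = "\<lambda>x::real. ?c * (x - x ^ 3 / 6)" and ?f = "\<lambda>x::real. ?c * (1 - x\<^sup>2 / 2)"
  interpret N: prob_space "density lborel (\<lambda>x. ennreal (std_normal_density x))"
    by (rule prob_space_normal_density) simp
  have "ennreal (23/24 / sqrt (2 * pi)) = ennreal (?F (1/2) - ?F (-(1/2)))"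
    by (intro arg_cong[of _ _ ennreal]) (simp add: field_simps power3_eq_cube)
  also have "\<dots> = (\<integral>\<^sup>+x. ennreal (?f x) * indicator {-(1/2)..1/2} x \<partial>lborel)"
  proof (rule nn_integral_FTC_Icc[symmetric])
    fix x :: real assume "x \<in> {-(1/2)..1/2}"
    then have "\<bar>x\<bar> \<le> 1" by auto
    then have "x\<^sup>2 \<le> 1" by (simp add: abs_square_le_1)
    then show "0 \<le> ?f x" by simp
    show "(?F has_real_derivative ?f x) (at x)"
      by (auto intro!: derivative_eq_intros simp: field_simps power2_eq_square)
  qed auto
  also have "\<dots> \<le> (\<integral>\<^sup>+x. ennreal (std_normal_density x) * indicator {-(1/2)..1/2} x \<partial>lborel)"
  proof (intro nn_integral_mono mult_right_mono ennreal_leI)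
    fix x :: real
    have "1 - x\<^sup>2 / 2 \<le> exp (- x\<^sup>2 / 2)" using exp_ge_add_one_self[of "- x\<^sup>2 / 2"] by simp
    then show "?f x \<le> std_normal_density x"
      by (simp add: std_normal_density_def divide_right_mono)
  qed auto
  also have "\<dots> = emeasure (density lborel std_normal_density) {-(1/2)..1/2}"
    by (subst emeasure_density) auto
  finally show ?thesis
    by (simp add: N.emeasure_eq_measure)
qed

text \<open>The crude bound \<open>pi < 4\<close> suffices, since \<open>(20/7)^2 = 400/49\<close>
  exceeds 8.\<close>

lemma inverse_sqrt_2pi_ge: "7/20 \<le> 1 / sqrt (2 * pi)"
proof -
  have "sqrt (2 * pi) \<le> 20/7"
    using pi_less_4 by (intro real_le_lsqrt) (auto simp: power2_eq_square)
  then show ?thesis by (simp add: field_simps)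
qed

text \<open>Hoeffding's inequality for the independent indicators of central rows. Each has mean at
  least the central mass, so \<open>B\<close> forces a deficit of at least \<open>n/100\<close> from
  the expected count; the exponent is \<open>2 (n/100)^2 / n = n/5000\<close>.\<close>

lemma prob_few_central_rows:
  fixes u :: "nat \<Rightarrow> real" and n d :: nat
  defines "G \<equiv> PiM ({..<n} \<times> {..<d}) (\<lambda>_. density lborel std_normal_density)"
    and "T \<equiv> (\<lambda>i (\<omega> :: nat \<times> nat \<Rightarrow> real). \<Sum>j<d. \<omega> (i, j) * u j)"
  defines "B \<equiv> {\<omega> \<in> space G. real (card {i \<in> {..<n}. \<bar>T i \<omega>\<bar> \<le> 1/2}) \<le> n * (23/24 / sqrt (2 * pi) - 1/100)}"
  assumes u: "(\<Sum>j<d. (u j)\<^sup>2) = 1" and n: "0 < n"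
  shows "B \<in> sets G" and "measure G B \<le> exp (- real n / 5000)"
proof -
  let ?N = "density lborel (\<lambda>x. ennreal (std_normal_density x))"
  have prob_N: "prob_space ?N" by (rule prob_space_normal_density) simp
  interpret G: prob_space G unfolding G_def by (rule prob_space_PiM) (rule prob_N)
  note rows = std_normal_row_combinations[OF u n, folded G_def T_def]
  define X where "X i \<omega> = indicat_real {-(1/2)..1/2} (T i \<omega>)" for i \<omega>
  have T_meas: "T i \<in> borel_measurable G" if "i < n" for i
    using rows(2)[OF that] by (simp add: distributed_def T_def)
  have indX: "G.indep_vars (\<lambda>_. borel) X {..<n}"
    unfolding X_def by (rule G.indep_vars_compose2[OF rows(1)]) auto
  have X_meas: "X i \<in> borel_measurable G" if "i < n" for i
    using indX that by (simp add: G.indep_vars_def)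
  have sum_X: "(\<Sum>i<n. X i \<omega>) = real (card {i \<in> {..<n}. \<bar>T i \<omega>\<bar> \<le> 1/2})" for \<omega>
  proof -
    have "(\<Sum>i<n. X i \<omega>) = (\<Sum>i<n. if \<bar>T i \<omega>\<bar> \<le> 1/2 then 1 else 0)"
      by (intro sum.cong) (auto simp: X_def indicator_def)
    then show ?thesis by (simp add: sum.If_cases Int_def)
  qed
  have "(\<lambda>\<omega>. \<Sum>i<n. X i \<omega>) \<in> borel_measurable G"
    using X_meas by (intro borel_measurable_sum) auto
  then show "B \<in> sets G" unfolding B_def sum_X[symmetric] by measurable
  have EX: "G.expectation (X i) \<ge> 23/24 / sqrt (2 * pi)" if i: "i < n" for i
  proof -
    have "G.expectation (X i) = G.expectation (indicat_real (T i -` {-(1/2)..1/2} \<inter> space G))"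
      by (intro Bochner_Integration.integral_cong) (auto simp: X_def indicator_def)
    also have "\<dots> = measure G (T i -` {-(1/2)..1/2} \<inter> space G)" by (simp add: Int_assoc)
    also have "\<dots> = measure (distr G lborel (T i)) {-(1/2)..1/2}"
      using T_meas[OF i] by (subst measure_distr) auto
    also have "distr G lborel (T i) = ?N"
      using rows(2)[OF i] by (simp add: distributed_def T_def)
    finally show ?thesis using std_normal_central_mass by simp
  qed
  define \<mu> where "\<mu> = (\<Sum>i<n. G.expectation (X i))"
  interpret H: Hoeffding_ineq G "{..<n}" X "\<lambda>_. 0" "\<lambda>_. 1" \<mu>
    using indX by unfold_locales (auto simp: X_def indicator_def \<mu>_def)
  have "n * (23/24 / sqrt (2 * pi)) \<le> \<mu>"
    unfolding \<mu>_def using sum_mono[of "{..<n}" "\<lambda>_. 23/24 / sqrt (2 * pi)" "\<lambda>i. G.expectation (X i)"] EX by simp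
  then have "B \<subseteq> {\<omega> \<in> space G. (\<Sum>i<n. X i \<omega>) \<le> \<mu> - real n / 100}"
    unfolding B_def sum_X[symmetric] by (auto simp: algebra_simps)
  then have "measure G B \<le> measure G {\<omega> \<in> space G. (\<Sum>i<n. X i \<omega>) \<le> \<mu> - real n / 100}"
    using X_meas by (intro G.finite_measure_mono) (auto intro!: borel_measurable_le borel_measurable_sum)
  also have "\<dots> \<le> exp (- 2 * (real n / 100)\<^sup>2 / (\<Sum>i<n. (1 - 0)\<^sup>2))"
    using n by (intro H.Hoeffding_ineq_le) auto
  also have "- 2 * (real n / 100)\<^sup>2 / (\<Sum>i<n. (1 - 0)\<^sup>2) = - real n / 5000"
    using n by (simp add: power2_eq_square field_simps)
  finally show "measure G B \<le> exp (- real n / 5000)" .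
qed


subsection \<open>The bound for a fixed design\<close>

text \<open>The base case holds because \<open>113/80\<close> is just below \<open>sqrt 2\<close>:
  its square is about 1.9952, against \<open>2 * 499/500 = 1.996\<close>. Each further factor
  \<open>b\<close> is absorbed by a new factor of the factorial, which is at least 3.\<close>

lemma power_le_fact:
  fixes b :: real
  assumes b: "0 \<le> b" "b \<le> 113/80" and k: "2 \<le> k"
  shows "b ^ k \<le> (499/500) ^ (k - 1) * fact k"
  using k
proof (induction k rule: dec_induct)
  case base
  have "b ^ 2 \<le> (113/80) ^ 2" using b by (intro power_mono) auto
  then show ?case by (simp add: power2_eq_square)
next
  case (step k)
  have "b ^ Suc k \<le> b * ((499/500) ^ (k - 1) * fact k)"
    using b step.IH by (simp add: mult_left_mono)
  also have "\<dots> \<le> (499/500 * real (Suc k)) * ((499/500) ^ (k - 1) * fact k)"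
    using b step.hyps by (intro mult_right_mono) auto
  also have "\<dots> = (499/500) ^ Suc (k - 1) * fact (Suc k)" by simp
  also have "Suc (k - 1) = Suc k - 1" using step.hyps by simp
  finally show ?case .
qed

text \<open>The quadratic Taylor bound is applied at \<open>1/4\<close> and raised to the fourth
  power. At 1 it gives only \<open>5/2\<close>, and \<open>1 + 1.1 / 2.5 = 1.44\<close> would
  already exceed \<open>sqrt 2\<close>.\<close>

lemma exp_1_ge: "8/3 \<le> exp (1::real)"
proof -
  have "(41/32) ^ 4 \<le> exp (1/4 :: real) ^ 4"
    using exp_lower_Taylor_quadratic[of "1/4"] by (intro power_mono) (auto simp: power2_eq_square)
  moreover have "exp (1/4 :: real) ^ 4 = exp 1" by (simp add: exp_of_nat_mult[symmetric])
  ultimately show ?thesis by (simp add: power_divide)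
qed

text \<open>Non-central points occupy at most one bin each, central ones at most
  \<open>1/w + 2\<close> bins in total. With \<open>c = 1 / sqrt (2 * pi)\<close>, the central count
  exceeds \<open>1/w\<close> by more than \<open>n * ((23/24 - 10/11) * c - 1/100)\<close>. As
  \<open>c\<close> is at least \<open>7/20\<close>, the factor of \<open>n\<close> is above 0.007,
  hence above \<open>1/200\<close>.\<close>

lemma central_bins_collide:
  fixes t :: "nat \<Rightarrow> real" and n :: nat
  defines "w \<equiv> 11/10 * sqrt (2 * pi) / n"
  assumes n: "0 < n"
    and central: "n * (23/24 / sqrt (2 * pi) - 1/100) < real (card {i \<in> {..<n}. \<bar>t i\<bar> \<le> 1/2})"
  shows "real n / 200 - 2 \<le> real (n - card ((\<lambda>i. \<lfloor>t i / w\<rfloor>) ` {..<n}))"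
proof -
  define C where "C = {i \<in> {..<n}. \<bar>t i\<bar> \<le> 1/2}"
  let ?lab = "\<lambda>i. \<lfloor>t i / w\<rfloor>" and ?R = "{\<lfloor>-(1/(2*w))\<rfloor>..\<lfloor>1/(2*w)\<rfloor>}"
  have w: "w > 0" using n by (simp add: w_def)
  have "?lab ` {..<n} \<subseteq> ?lab ` ({..<n} - C) \<union> ?R"
  proof
    fix l assume "l \<in> ?lab ` {..<n}"
    then obtain i where i: "i < n" "l = ?lab i" by auto
    show "l \<in> ?lab ` ({..<n} - C) \<union> ?R"
    proof (cases "i \<in> C")
      case True
      then have "-(1/2) \<le> t i" "t i \<le> 1/2" by (auto simp: C_def abs_le_iff)
      then have "-(1/(2*w)) \<le> t i / w" "t i / w \<le> 1/(2*w)"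
        using w by (simp_all add: field_simps)
      then have "l \<in> ?R" unfolding i(2) by (simp only: atLeastAtMost_iff floor_mono)
      then show ?thesis ..
    qed (use i in auto)
  qed
  then have "card (?lab ` {..<n}) \<le> card (?lab ` ({..<n} - C) \<union> ?R)"
    by (intro card_mono) auto
  also have "\<dots> \<le> card (?lab ` ({..<n} - C)) + card ?R" by (rule card_Un_le)
  also have "card (?lab ` ({..<n} - C)) \<le> card ({..<n} - C)" by (rule card_image_le) simp
  also have "card ({..<n} - C) = n - card C"
    by (subst card_Diff_subset) (auto simp: C_def)
  finally have D: "card (?lab ` {..<n}) \<le> n - card C + card ?R" by simp
  have "card C \<le> card {..<n}" by (rule card_mono) (auto simp: C_def)
  then have C_le: "card C \<le> n" by simp
  \<comment> \<open>The interval has length 1; rounding at its two ends accounts for the extra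
    2.\<close>
  have "real (card ?R) \<le> 1 / w + 2"
  proof -
    have "\<lfloor>-(1/(2*w))\<rfloor> \<le> \<lfloor>1/(2*w)\<rfloor>" using w by (intro floor_mono) (simp add: field_simps)
    then have "real (card ?R) = real_of_int (\<lfloor>1/(2*w)\<rfloor> + 1 - \<lfloor>-(1/(2*w))\<rfloor>)" by simp
    also have "\<dots> \<le> 1/(2*w) + 1 - (-(1/(2*w)) - 1)" by linarith
    also have "\<dots> = 1 / w + 2" using w by (simp add: field_simps)
    finally show ?thesis .
  qed
  then have "real (card C) - 1 / w - 2 \<le> real (n - card (?lab ` {..<n}))"
    using D C_le by linarith
  moreover have "1 / w = n * (10/11 * (1 / sqrt (2 * pi)))" using n by (simp add: w_def)
  moreover have "n * (23/24 * (1 / sqrt (2 * pi)) - 1/100) < real (card C)" using central by (simp add: C_def)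
  moreover have "n * (7/20) \<le> n * (1 / sqrt (2 * pi))"
    using inverse_sqrt_2pi_ge by (intro mult_left_mono) auto
  ultimately show ?thesis by (simp add: right_diff_distrib)
qed

text \<open>Here \<open>s\<close> plays the role of the norm of \<open>x\<close>, and the
  \<open>t i\<close> are the normalized entries of \<open>A x\<close>. The label of an index is its
  bin, and the envelope of a bin spans the means found in it.\<close>

lemma sum_emeasure_permuted_binned_le:
  fixes t :: "nat \<Rightarrow> real" and n :: nat and \<sigma> :: real
  assumes \<sigma>: "\<sigma> > 0" and s: "0 \<le> s" "s * exp 1 \<le> \<sigma> * n" and n: "0 < n"
    and central: "n * (23/24 / sqrt (2 * pi) - 1/100) < real (card {i \<in> {..<n}. \<bar>t i\<bar> \<le> 1/2})"
    and E: "\<And>\<pi>. \<pi> permutes {..<n} \<Longrightarrow> E \<pi> \<in> sets (PiM {..<n} (\<lambda>_. borel))"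
    and disj: "disjoint_family_on E {\<pi>. \<pi> permutes {..<n}}"
  shows "(\<Sum>\<pi> | \<pi> permutes {..<n}.
            emeasure (PiM {..<n} (\<lambda>i. density lborel (normal_density (s * t (\<pi> i)) \<sigma>))) (E \<pi>))
         \<le> ennreal (fact n * exp (1/250 - real n / 100000))"
proof -
  define w where "w = 11/10 * sqrt (2 * pi) / n"
  define lab where "lab i = \<lfloor>t i / w\<rfloor>" for i
  define J where "J l = {j \<in> {..<n}. lab j = l}" for l
  \<comment> \<open>Extremes of the points actually present, not bin endpoints: a bin with one point
    then has \<open>\<beta> l = 1\<close>, as the counting bound demands when
    \<open>k = 1\<close>.\<close>
  define lo where "lo l = Min ((\<lambda>j. s * t j) ` J l)" for l
  define hi where "hi l = Max ((\<lambda>j. s * t j) ` J l)" for l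
  define \<beta> where "\<beta> l = 1 + (hi l - lo l) / (\<sigma> * sqrt (2 * pi))" for l
  have w: "w > 0" using n by (simp add: w_def)
  have finJ: "finite (J l)" for l by (simp add: J_def)
  have J_ne: "J l \<noteq> {}" if "l \<in> lab ` {..<n}" for l using that by (auto simp: J_def)
  have between: "lo (lab j) \<le> s * t j" "s * t j \<le> hi (lab j)" if "j < n" for j
    using that finJ by (auto simp: lo_def hi_def J_def intro!: Min_le Max_ge)
  have lo_hi: "lo l \<le> hi l" if "l \<in> lab ` {..<n}" for l
    using that between by force
  have \<beta>_ge: "1 \<le> \<beta> l" if "l \<in> lab ` {..<n}" for l
    using lo_hi[OF that] \<sigma> by (simp add: \<beta>_def)
  have \<beta>_le: "\<beta> l \<le> 113/80" if l: "l \<in> lab ` {..<n}" for l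
  proof -
    have "lo l \<in> (\<lambda>j. s * t j) ` J l" "hi l \<in> (\<lambda>j. s * t j) ` J l"
      unfolding lo_def hi_def using finJ J_ne[OF l] by (auto intro!: Min_in Max_in)
    then obtain i j where ij: "i \<in> J l" "j \<in> J l" "lo l = s * t i" "hi l = s * t j" by auto
    have "\<lfloor>t i / w\<rfloor> = \<lfloor>t j / w\<rfloor>" using ij by (simp add: J_def lab_def)
    then have "t j / w - t i / w \<le> 1" by linarith
    then have "t j - t i \<le> w" using w by (simp add: field_simps)
    then have "hi l - lo l \<le> s * w"
      using s ij by (metis mult_left_mono right_diff_distrib)
    then have "(hi l - lo l) / (\<sigma> * sqrt (2 * pi)) \<le> s * w / (\<sigma> * sqrt (2 * pi))"
      using \<sigma> by (intro divide_right_mono) auto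
    \<comment> \<open>The factor \<open>sqrt (2 * pi)\<close> in \<open>w\<close> cancels. Then
      \<open>s * exp 1\<close> \<le> \<open>\<sigma> * n\<close> and \<open>exp 1\<close> \<ge>
      \<open>8/3\<close> bound the quotient by \<open>11/10 * 3/8 = 33/80\<close>.\<close>
    also have "\<dots> = 11/10 * s / (\<sigma> * n)" by (simp add: w_def mult_ac)
    also have "\<dots> \<le> 33/80"
    proof -
      have "s * (8/3) \<le> s * exp 1" using s exp_1_ge by (intro mult_left_mono) auto
      then show ?thesis using s \<sigma> n by (simp add: field_simps)
    qed
    finally show ?thesis by (simp add: \<beta>_def)
  qed
  have \<beta>_single: "\<beta> l = 1" if "card (J l) = 1" for l
    using that by (auto simp: card_1_singleton_iff \<beta>_def lo_def hi_def)
  have "(\<Sum>\<pi> | \<pi> permutes {..<n}.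
            emeasure (PiM {..<n} (\<lambda>i. density lborel (normal_density (s * t (\<pi> i)) \<sigma>))) (E \<pi>))
      \<le> ennreal (real (card (permutations_of_multiset (mset (map lab [0..<n])))) * (\<Prod>j<n. \<beta> (lab j)))"
  proof (rule sum_emeasure_permuted_le[OF \<sigma>, where psi = "\<lambda>l. gauss_envelope \<sigma> (lo l) (hi l)"])
    fix j assume j: "j < n"
    show "normal_density (s * t j) \<sigma> y \<le> gauss_envelope \<sigma> (lo (lab j)) (hi (lab j)) y" for y
      using between[OF j] by (rule normal_density_le_gauss_envelope[OF \<sigma>])
    show "(\<integral>\<^sup>+y. ennreal (gauss_envelope \<sigma> (lo (lab j)) (hi (lab j)) y) \<partial>lborel) \<le> ennreal (\<beta> (lab j))"
      unfolding \<beta>_def using lo_hi j by (intro nn_integral_gauss_envelope[OF \<sigma>]) auto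
    show "0 \<le> \<beta> (lab j)" using \<beta>_ge[of "lab j"] j by simp
  qed (use E disj in auto)
  also have "real (card (permutations_of_multiset (mset (map lab [0..<n])))) * (\<Prod>j<n. \<beta> (lab j))
      \<le> fact n * (499/500) ^ (n - card (lab ` {..<n}))"
  proof (rule card_permutations_of_multiset_prod_le)
    fix l assume l: "l \<in> lab ` {..<n}"
    show "0 \<le> \<beta> l" using \<beta>_ge[OF l] by simp
    have "card (J l) \<noteq> 0" using J_ne[OF l] finJ by simp
    then consider "card (J l) = 1" | "2 \<le> card (J l)" by linarith
    then have "\<beta> l ^ card (J l) \<le> (499/500) ^ (card (J l) - 1) * fact (card (J l))"
    proof cases
      case 1
      then show ?thesis by (simp add: \<beta>_single)
    next
      case 2
      then show ?thesis using \<beta>_ge[OF l] \<beta>_le[OF l] by (intro power_le_fact) auto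
    qed
    then show "\<beta> l ^ card {j \<in> {..<n}. lab j = l}
        \<le> (499/500) ^ (card {j \<in> {..<n}. lab j = l} - 1) * fact (card {j \<in> {..<n}. lab j = l})"
      by (simp only: J_def)
  qed simp
  \<comment> \<open>Since \<open>499/500\<close> \<le> \<open>exp (- 1/500)\<close>, an exponent of
    at least \<open>n/200 - 2\<close> yields \<open>n/100000 - 1/250\<close>.\<close>
  also have "(499/500 :: real) ^ (n - card (lab ` {..<n})) \<le> exp (1/250 - real n / 100000)"
  proof -
    define m where "m = n - card (lab ` {..<n})"
    have m: "real n / 200 - 2 \<le> real m"
      unfolding m_def lab_def w_def by (rule central_bins_collide[OF n central])
    have "(499/500 :: real) ^ m \<le> exp (- (1/500)) ^ m"
      using exp_ge_add_one_self[of "- (1/500)"] by (intro power_mono) auto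
    also have "\<dots> = exp (real m * - (1/500))" by (rule exp_of_nat_mult[symmetric])
    also have "\<dots> \<le> exp (1/250 - real n / 100000)" using m by simp
    finally show ?thesis by (simp add: m_def)
  qed
  finally show ?thesis by (simp add: ennreal_leI mult_left_mono)
qed


subsection \<open>Permutation matrices and success events\<close>

text \<open>Row \<open>i\<close> selects entry \<open>\<pi> i\<close>, so coordinate
  \<open>i\<close> of the observation has mean \<open>(A x) $ \<pi> i\<close>.\<close>

definition perm_mat :: "nat \<Rightarrow> (nat \<Rightarrow> nat) \<Rightarrow> real mat" where
  "perm_mat n \<pi> = mat n n (\<lambda>(i, j). if j = \<pi> i then 1 else 0)"

lemma index_perm_mat:
  "i < n \<Longrightarrow> j < n \<Longrightarrow> perm_mat n \<pi> $$ (i, j) = (if j = \<pi> i then 1 else 0)"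
  by (simp add: perm_mat_def)

lemma perm_mat_in_perm_mats:
  assumes "\<pi> permutes {..<n}"
  shows "perm_mat n \<pi> \<in> perm_mats n"
  unfolding perm_mats_def
proof (intro CollectI conjI allI impI)
  have img: "\<pi> i < n \<longleftrightarrow> i < n" for i using permutes_in_image[OF assms, of i] by simp
  show "perm_mat n \<pi> \<in> carrier_mat n n" by (simp add: perm_mat_def)
  show "perm_mat n \<pi> $$ (i, j) \<in> {0, 1}" if "i < n" "j < n" for i j
    using that by (simp add: index_perm_mat)
  show "\<exists>!j. j < n \<and> perm_mat n \<pi> $$ (i, j) = 1" if i: "i < n" for i
  proof (rule ex1I[of _ "\<pi> i"])
    show "\<pi> i < n \<and> perm_mat n \<pi> $$ (i, \<pi> i) = 1" using i img[of i] by (simp add: index_perm_mat)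
    show "j = \<pi> i" if "j < n \<and> perm_mat n \<pi> $$ (i, j) = 1" for j
      using that i by (auto simp: index_perm_mat split: if_splits)
  qed
  show "\<exists>!i. i < n \<and> perm_mat n \<pi> $$ (i, j) = 1" if j: "j < n" for j
  proof -
    obtain i where i: "\<pi> i = j" using permutes_surj[OF assms] by (metis surjD)
    show ?thesis
    proof (rule ex1I[of _ i])
      show "i < n \<and> perm_mat n \<pi> $$ (i, j) = 1" using i j img[of i] by (simp add: index_perm_mat)
      show "i' = i" if "i' < n \<and> perm_mat n \<pi> $$ (i', j) = 1" for i'
      proof -
        have "j = \<pi> i'" using that j by (auto simp: index_perm_mat split: if_splits)
        then have "\<pi> i' = \<pi> i" by (simp only: i)
        then show ?thesis by (rule injD[OF permutes_inj[OF assms]])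
      qed
    qed
  qed
qed

text \<open>An estimator returns a single matrix per observation, so injectivity makes the regions
  of correct recovery disjoint for distinct permutations.\<close>

lemma inj_on_perm_mat: "inj_on (perm_mat n) {\<pi>. \<pi> permutes {..<n}}"
proof (rule inj_onI, clarify)
  fix \<pi> \<pi>' assume p: "\<pi> permutes {..<n}" "\<pi>' permutes {..<n}" and eq: "perm_mat n \<pi> = perm_mat n \<pi>'"
  show "\<pi> = \<pi>'"
  proof
    fix i
    show "\<pi> i = \<pi>' i"
    proof (cases "i < n")
      case True
      then have "\<pi> i < n" using permutes_in_image[OF p(1), of i] by simp
      with True have "perm_mat n \<pi> $$ (i, \<pi> i) = 1" by (simp add: index_perm_mat)
      then have "perm_mat n \<pi>' $$ (i, \<pi> i) = 1" by (simp only: eq)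
      with True \<open>\<pi> i < n\<close> show ?thesis by (auto simp: index_perm_mat split: if_splits)
    next
      case False
      then show ?thesis using permutes_not_in[OF p(1), of i] permutes_not_in[OF p(2), of i] by simp
    qed
  qed
qed

lemma observation_perm_mat:
  assumes \<pi>: "\<pi> permutes {..<n}" and A: "A \<in> carrier_mat n d" and x: "x \<in> carrier_vec d"
  shows "observation (perm_mat n \<pi>) x A (vec n z) = vec n (\<lambda>i. (A *\<^sub>v x) $ \<pi> i + z i)"
proof (rule eq_vecI)
  fix i assume "i < dim_vec (vec n (\<lambda>i. (A *\<^sub>v x) $ \<pi> i + z i))"
  then have i: "i < n" by simp
  then have \<pi>i: "\<pi> i < n" using permutes_in_image[OF \<pi>, of i] by simp
  have "(perm_mat n \<pi> *\<^sub>v (A *\<^sub>v x)) $ i = (\<Sum>j\<in>{0..<n}. (if j = \<pi> i then 1 else 0) * (A *\<^sub>v x) $ j)"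
    using i A by (auto simp: perm_mat_def scalar_prod_def intro!: sum.cong)
  also have "\<dots> = (\<Sum>j\<in>{0..<n}. if j = \<pi> i then (A *\<^sub>v x) $ j else 0)" by (intro sum.cong) auto
  also have "\<dots> = (A *\<^sub>v x) $ \<pi> i" using \<pi>i by simp
  finally show "observation (perm_mat n \<pi>) x A (vec n z) $ i = vec n (\<lambda>i. (A *\<^sub>v x) $ \<pi> i + z i) $ i"
    using i by (simp add: observation_def)
qed (simp add: observation_def)

definition success_event ::
  "nat \<Rightarrow> nat \<Rightarrow> real \<Rightarrow> real vec \<Rightarrow> real mat \<Rightarrow> (real vec \<Rightarrow> real mat \<Rightarrow> real mat)
     \<Rightarrow> (real mat \<times> real vec) set" where
  "success_event n d \<sigma> x P Phat =
     space (gaussian_mat n d \<Otimes>\<^sub>M gaussian_vec n \<sigma>) - error_event n d \<sigma> x P Phat"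

lemma vec_measurable: "vec n \<in> PiM {..<n} (\<lambda>_. borel) \<rightarrow>\<^sub>M borel_vec n"
  by (rule measurable_to_borel_vec) auto

lemma mat_measurable: "mat n d \<in> PiM ({..<n} \<times> {..<d}) (\<lambda>_. borel) \<rightarrow>\<^sub>M borel_mat n d"
  by (rule measurable_to_borel_mat) auto

text \<open>For a fixed design, pass from the noise to the observation as the variable. Success
  becomes the decision region \<open>E\<close> of the estimator, and the true means enter only
  through the law of the observation.\<close>

lemma emeasure_success_slice:
  assumes \<sigma>: "\<sigma> > 0" and \<pi>: "\<pi> permutes {..<n}" and A: "A \<in> carrier_mat n d" and x: "x \<in> carrier_vec d"
    and Phat: "Phat \<in> estimators n d"
  defines "E \<equiv> {y \<in> space (PiM {..<n} (\<lambda>_. borel)). Phat (vec n y) A = perm_mat n \<pi>}"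
  shows "E \<in> sets (PiM {..<n} (\<lambda>_. borel))"
    and "emeasure (gaussian_vec n \<sigma>) (Pair A -` success_event n d \<sigma> x (perm_mat n \<pi>) Phat)
      = emeasure (PiM {..<n} (\<lambda>i. density lborel (normal_density ((A *\<^sub>v x) $ \<pi> i) \<sigma>))) E"
proof -
  let ?P = "perm_mat n \<pi>" and ?S = "success_event n d \<sigma> x (perm_mat n \<pi>) Phat"
  let ?N = "PiM {..<n} (\<lambda>_. density lborel (normal_density 0 \<sigma>))"
  let ?T = "\<lambda>z. \<lambda>i\<in>{..<n}. (A *\<^sub>v x) $ \<pi> i + z i"
  have sN: "sets ?N = sets (PiM {..<n} (\<lambda>_. borel))" by (intro sets_PiM_cong) auto
  have P: "?P \<in> perm_mats n" by (rule perm_mat_in_perm_mats[OF \<pi>])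
  have "(\<lambda>y. (vec n y, A)) \<in> PiM {..<n} (\<lambda>_. borel) \<rightarrow>\<^sub>M borel_vec n \<Otimes>\<^sub>M borel_mat n d"
    using A by (intro measurable_Pair vec_measurable) simp
  from measurable_compose[OF this, of "\<lambda>(y, A). Phat y A" "count_space (perm_mats n)"] Phat
  have est: "(\<lambda>y. Phat (vec n y) A) \<in> PiM {..<n} (\<lambda>_. borel) \<rightarrow>\<^sub>M count_space (perm_mats n)"
    by (simp add: estimators_def)
  have "E = (\<lambda>y. Phat (vec n y) A) -` {?P} \<inter> space (PiM {..<n} (\<lambda>_. borel))"
    by (auto simp: E_def)
  then show E: "E \<in> sets (PiM {..<n} (\<lambda>_. borel))"
    using measurable_sets[OF est, of "{?P}"] P by simp
  have T: "?T \<in> ?N \<rightarrow>\<^sub>M PiM {..<n} (\<lambda>_. borel)"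
    unfolding measurable_cong_sets[OF sN refl] by (intro measurable_restrict) measurable
  have V: "vec n \<in> ?N \<rightarrow>\<^sub>M borel_vec n"
    unfolding measurable_cong_sets[OF sN refl] by (rule vec_measurable)
  have S: "?S \<in> sets (gaussian_mat n d \<Otimes>\<^sub>M gaussian_vec n \<sigma>)"
    unfolding success_event_def using error_event_measurable[OF x P Phat] by auto
  have "emeasure (gaussian_vec n \<sigma>) (Pair A -` ?S) = emeasure ?N (vec n -` (Pair A -` ?S) \<inter> space ?N)"
    using sets_Pair1[OF S, of A] unfolding gaussian_vec_def
    by (intro emeasure_distr V) simp
  also have "vec n -` (Pair A -` ?S) \<inter> space ?N = ?T -` E \<inter> space ?N"
  proof -
    have "vec n z \<in> Pair A -` ?S \<longleftrightarrow> ?T z \<in> E" for z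
    proof -
      have "vec n z \<in> Pair A -` ?S \<longleftrightarrow> Phat (observation ?P x A (vec n z)) A = ?P"
        using A by (auto simp: success_event_def error_event_def space_pair_measure gaussian_mat_def gaussian_vec_def)
      also have "observation ?P x A (vec n z) = vec n (?T z)"
        unfolding observation_perm_mat[OF \<pi> A x] by (intro eq_vecI) auto
      finally show ?thesis by (simp add: E_def space_PiM)
    qed
    then show ?thesis by auto
  qed
  also have "emeasure ?N \<dots> = emeasure (distr ?N (PiM {..<n} (\<lambda>_. borel)) ?T) E"
    by (rule emeasure_distr[OF T E, symmetric])
  also have "\<dots> = emeasure (PiM {..<n} (\<lambda>i. density lborel (normal_density ((A *\<^sub>v x) $ \<pi> i) \<sigma>))) E"
    by (subst distr_PiM_normal_shift) (simp_all add: \<sigma>)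
  finally show "emeasure (gaussian_vec n \<sigma>) (Pair A -` ?S)
      = emeasure (PiM {..<n} (\<lambda>i. density lborel (normal_density ((A *\<^sub>v x) $ \<pi> i) \<sigma>))) E" .
qed

lemma scalar_prod_self_eq_sum:
  fixes x :: "real vec"
  assumes "x \<in> carrier_vec d"
  shows "x \<bullet> x = (\<Sum>j<d. (x $ j)\<^sup>2)"
  using assms by (auto simp: scalar_prod_def power2_eq_square atLeast0LessThan)

subsection \<open>Averaging over the design\<close>

text \<open>Normalize \<open>x\<close>; if \<open>x\<close> vanishes any unit vector serves, and the
  first basis vector exists because \<open>d\<close> is positive.\<close>

lemma exists_unit_direction:
  fixes x :: "real vec"
  assumes x: "x \<in> carrier_vec d" and d: "1 \<le> d"
  obtains u :: "nat \<Rightarrow> real" where "(\<Sum>j<d. (u j)\<^sup>2) = 1"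
    and "\<And>j. j < d \<Longrightarrow> x $ j = sqrt (x \<bullet> x) * u j"
proof -
  define s where "s = sqrt (x \<bullet> x)"
  note xx = scalar_prod_self_eq_sum[OF x]
  show ?thesis
  proof (cases "x \<bullet> x = 0")
    case True
    then have "x $ j = 0" if "j < d" for j
      using that unfolding xx by (simp add: sum_nonneg_eq_0_iff)
    moreover have "(\<Sum>j<d. (if j = 0 then 1 else 0 :: real)\<^sup>2) = 1"
    proof -
      have "(\<Sum>j<d. (if j = 0 then 1 else 0 :: real)\<^sup>2) = (\<Sum>j<d. if j = 0 then 1 else 0)"
        by (intro sum.cong) auto
      then show ?thesis using d by simp
    qed
    ultimately show ?thesis using True by (intro that[of "\<lambda>j. if j = 0 then 1 else 0"]) auto
  next
    case False
    moreover have "x \<bullet> x \<ge> 0" unfolding xx by (intro sum_nonneg) simp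
    ultimately have "x \<bullet> x > 0" by linarith
    then have s: "s > 0" "s\<^sup>2 = x \<bullet> x" by (simp_all add: s_def)
    have "(\<Sum>j<d. (x $ j / s)\<^sup>2) = (\<Sum>j<d. (x $ j)\<^sup>2) / s\<^sup>2"
      by (simp add: power_divide sum_divide_distrib)
    also have "\<dots> = 1" using s False by (simp flip: xx)
    finally have "(\<Sum>j<d. (x $ j / s)\<^sup>2) = 1" .
    then show ?thesis using s(1) by (intro that[of "\<lambda>j. x $ j / s"]) (auto simp: s_def)
  qed
qed

text \<open>Integrate over the design. On the rare event \<open>B\<close> of too few central rows,
  each of the \<open>n!\<close> conditional success probabilities is bounded by 1; elsewhere the
  bound for a fixed design applies.\<close>

lemma sum_success_le:
  fixes x :: "real vec"
  assumes \<sigma>: "\<sigma> > 0" and n: "0 < n" and d: "1 \<le> d" and x: "x \<in> carrier_vec d"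
    and snr: "sqrt (x \<bullet> x) * exp 1 \<le> \<sigma> * real n" and Phat: "Phat \<in> estimators n d"
  shows "(\<Sum>\<pi> | \<pi> permutes {..<n}. measure (gaussian_mat n d \<Otimes>\<^sub>M gaussian_vec n \<sigma>) (success_event n d \<sigma> x (perm_mat n \<pi>) Phat))
    \<le> fact n * (exp (1/250 - real n / 100000) + exp (- real n / 5000))"
proof -
  let ?S = "\<lambda>\<pi>. success_event n d \<sigma> x (perm_mat n \<pi>) Phat"
  let ?Pi = "{\<pi>. \<pi> permutes {..<n}}"
  let ?q = "exp (1/250 - real n / 100000)"
  define G where "G = PiM ({..<n} \<times> {..<d}) (\<lambda>_. density lborel std_normal_density)"
  obtain u where u: "(\<Sum>j<d. (u j)\<^sup>2) = 1" and xu: "\<And>j. j < d \<Longrightarrow> x $ j = sqrt (x \<bullet> x) * u j"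
    using exists_unit_direction[OF x d] by blast
  define T where "T i \<omega> = (\<Sum>j<d. \<omega> (i, j) * u j)" for i and \<omega> :: "nat \<times> nat \<Rightarrow> real"
  define B where "B = {\<omega> \<in> space G. real (card {i \<in> {..<n}. \<bar>T i \<omega>\<bar> \<le> 1/2}) \<le> n * (23/24 / sqrt (2 * pi) - 1/100)}"
  note few = prob_few_central_rows[OF u n, folded T_def G_def, folded B_def]
  interpret GM: prob_space "gaussian_mat n d" by (rule prob_space_gaussian_mat)
  interpret GV: prob_space "gaussian_vec n \<sigma>" by (rule prob_space_gaussian_vec[OF \<sigma>])
  interpret GP: pair_prob_space "gaussian_mat n d" "gaussian_vec n \<sigma>" ..
  interpret G: prob_space G
    unfolding G_def by (intro prob_space_PiM prob_space_normal_density) auto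
  have finPi: "finite ?Pi" by (simp add: finite_permutations)
  have card_Pi: "card ?Pi = fact n" by (simp add: card_permutations)
  have S: "?S \<pi> \<in> sets (gaussian_mat n d \<Otimes>\<^sub>M gaussian_vec n \<sigma>)" if "\<pi> \<in> ?Pi" for \<pi>
    unfolding success_event_def
    using error_event_measurable[OF x perm_mat_in_perm_mats Phat, of \<pi>] that by auto
  have sG: "sets G = sets (PiM ({..<n} \<times> {..<d}) (\<lambda>_. borel))"
    unfolding G_def by (intro sets_PiM_cong) auto
  have M: "mat n d \<in> G \<rightarrow>\<^sub>M borel_mat n d"
    unfolding measurable_cong_sets[OF sG refl] by (rule mat_measurable)
  have slice: "(\<Sum>\<pi>\<in>?Pi. emeasure (gaussian_vec n \<sigma>) (Pair (mat n d \<omega>) -` ?S \<pi>))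
      \<le> ennreal (fact n * ?q) + ennreal (fact n) * indicator B \<omega>" if \<omega>: "\<omega> \<in> space G" for \<omega>
  proof (cases "\<omega> \<in> B")
    case True
    have "(\<Sum>\<pi>\<in>?Pi. emeasure (gaussian_vec n \<sigma>) (Pair (mat n d \<omega>) -` ?S \<pi>)) \<le> (\<Sum>\<pi>\<in>?Pi. 1)"
      by (intro sum_mono GV.measure_le_1)
    also have "\<dots> = ennreal (fact n)" by (simp add: card_Pi ennreal_of_nat_eq_real_of_nat)
    finally show ?thesis using True by (simp add: add_increasing)
  next
    case False
    define A where "A = mat n d \<omega>"
    define E where "E \<pi> = {y \<in> space (PiM {..<n} (\<lambda>_. borel)). Phat (vec n y) A = perm_mat n \<pi>}" for \<pi>
    have A: "A \<in> carrier_mat n d" by (simp add: A_def)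
    have Ax: "(A *\<^sub>v x) $ i = sqrt (x \<bullet> x) * T i \<omega>" if "i < n" for i
    proof -
      have "(A *\<^sub>v x) $ i = (\<Sum>j<d. \<omega> (i, j) * x $ j)"
        using that x by (auto simp: A_def scalar_prod_def atLeast0LessThan intro!: sum.cong)
      also have "\<dots> = (\<Sum>j<d. sqrt (x \<bullet> x) * (\<omega> (i, j) * u j))"
        by (intro sum.cong refl) (simp add: xu)
      finally show ?thesis by (simp add: T_def sum_distrib_left)
    qed
    have "(\<Sum>\<pi>\<in>?Pi. emeasure (gaussian_vec n \<sigma>) (Pair A -` ?S \<pi>))
      = (\<Sum>\<pi>\<in>?Pi. emeasure (PiM {..<n} (\<lambda>i. density lborel (normal_density (sqrt (x \<bullet> x) * T (\<pi> i) \<omega>) \<sigma>))) (E \<pi>))"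
    proof (intro sum.cong refl)
      fix \<pi> assume "\<pi> \<in> ?Pi"
      then have \<pi>: "\<pi> permutes {..<n}" by simp
      have "PiM {..<n} (\<lambda>i. density lborel (normal_density ((A *\<^sub>v x) $ \<pi> i) \<sigma>))
        = PiM {..<n} (\<lambda>i. density lborel (normal_density (sqrt (x \<bullet> x) * T (\<pi> i) \<omega>) \<sigma>))"
        using permutes_in_image[OF \<pi>] by (intro PiM_cong refl) (auto simp: Ax)
      then show "emeasure (gaussian_vec n \<sigma>) (Pair A -` ?S \<pi>)
        = emeasure (PiM {..<n} (\<lambda>i. density lborel (normal_density (sqrt (x \<bullet> x) * T (\<pi> i) \<omega>) \<sigma>))) (E \<pi>)"
        using emeasure_success_slice(2)[OF \<sigma> \<pi> A x Phat] by (simp add: E_def)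
    qed
    also have "\<dots> \<le> ennreal (fact n * ?q)"
    proof (rule sum_emeasure_permuted_binned_le[OF \<sigma> _ snr n])
      show "0 \<le> sqrt (x \<bullet> x)"
        using scalar_prod_self_eq_sum[OF x] by (simp add: sum_nonneg)
      show "n * (23/24 / sqrt (2 * pi) - 1/100) < real (card {i \<in> {..<n}. \<bar>T i \<omega>\<bar> \<le> 1/2})"
        using False \<omega> by (simp add: B_def)
      show "E \<pi> \<in> sets (PiM {..<n} (\<lambda>_. borel))" if "\<pi> permutes {..<n}" for \<pi>
        unfolding E_def by (rule emeasure_success_slice(1)[OF \<sigma> that A x Phat])
      show "disjoint_family_on E ?Pi"
        using inj_on_perm_mat[of n] by (auto simp: disjoint_family_on_def E_def dest: inj_onD)
    qed
    finally show ?thesis using False by (simp add: A_def)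
  qed
  have "ennreal (\<Sum>\<pi>\<in>?Pi. measure (gaussian_mat n d \<Otimes>\<^sub>M gaussian_vec n \<sigma>) (?S \<pi>))
      = (\<Sum>\<pi>\<in>?Pi. emeasure (gaussian_mat n d \<Otimes>\<^sub>M gaussian_vec n \<sigma>) (?S \<pi>))"
    by (simp add: GP.emeasure_eq_measure sum_ennreal)
  also have "\<dots> = (\<Sum>\<pi>\<in>?Pi. \<integral>\<^sup>+A. emeasure (gaussian_vec n \<sigma>) (Pair A -` ?S \<pi>) \<partial>gaussian_mat n d)"
    by (intro sum.cong refl GV.emeasure_pair_measure_alt S)
  \<comment> \<open>The law of the matrix is the image of \<open>G\<close>, the space of entry
    arrays on which the event \<open>B\<close> is defined.\<close>
  also have "\<dots> = (\<Sum>\<pi>\<in>?Pi. \<integral>\<^sup>+\<omega>. emeasure (gaussian_vec n \<sigma>) (Pair (mat n d \<omega>) -` ?S \<pi>) \<partial>G)"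
  proof (intro sum.cong refl)
    fix \<pi> assume \<pi>: "\<pi> \<in> ?Pi"
    have "(\<lambda>A. emeasure (gaussian_vec n \<sigma>) (Pair A -` ?S \<pi>)) \<in> borel_measurable (gaussian_mat n d)"
      by (rule GV.measurable_emeasure_Pair[OF S[OF \<pi>]])
    then show "(\<integral>\<^sup>+A. emeasure (gaussian_vec n \<sigma>) (Pair A -` ?S \<pi>) \<partial>gaussian_mat n d)
        = (\<integral>\<^sup>+\<omega>. emeasure (gaussian_vec n \<sigma>) (Pair (mat n d \<omega>) -` ?S \<pi>) \<partial>G)"
      using M unfolding gaussian_mat_def G_def[symmetric] by (subst nn_integral_distr) auto
  qed
  also have "\<dots> = (\<integral>\<^sup>+\<omega>. (\<Sum>\<pi>\<in>?Pi. emeasure (gaussian_vec n \<sigma>) (Pair (mat n d \<omega>) -` ?S \<pi>)) \<partial>G)"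
  proof (intro nn_integral_sum[symmetric])
    fix \<pi> assume \<pi>: "\<pi> \<in> ?Pi"
    have "mat n d \<in> G \<rightarrow>\<^sub>M gaussian_mat n d" using M by (simp add: gaussian_mat_def)
    from measurable_compose[OF this GV.measurable_emeasure_Pair[OF S[OF \<pi>]]]
    show "(\<lambda>\<omega>. emeasure (gaussian_vec n \<sigma>) (Pair (mat n d \<omega>) -` ?S \<pi>)) \<in> borel_measurable G" .
  qed
  also have "\<dots> \<le> (\<integral>\<^sup>+\<omega>. ennreal (fact n * ?q) + ennreal (fact n) * indicator B \<omega> \<partial>G)"
    by (intro nn_integral_mono slice)
  also have "\<dots> = ennreal (fact n * ?q) + ennreal (fact n) * emeasure G B"
    using few(1) by (subst nn_integral_add) (auto simp: nn_integral_cmult_indicator G.emeasure_space_1)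
  also have "\<dots> = ennreal (fact n * (?q + measure G B))"
    by (simp add: G.emeasure_eq_measure distrib_left flip: ennreal_mult ennreal_plus)
  finally have "(\<Sum>\<pi>\<in>?Pi. measure (gaussian_mat n d \<Otimes>\<^sub>M gaussian_vec n \<sigma>) (?S \<pi>)) \<le> fact n * (?q + measure G B)"
    by (subst (asm) ennreal_le_iff) auto
  also have "\<dots> \<le> fact n * (?q + exp (- real n / 5000))"
    using few(2) by (intro mult_left_mono) auto
  finally show ?thesis .
qed

text \<open>The success probabilities average to at most \<open>?b\<close> over the permutations, so
  some permutation does no better than \<open>?b\<close>. The witnesses are \<open>c3 = 4\<close>
  and \<open>c4 = 1/200000\<close>.\<close>

theorem theorem2:
  shows "\<exists>c3 c4 :: real. c3 > 0 \<and> c4 > 0 \<and>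
    (\<forall>(n :: nat) (d :: nat) (x :: real vec) (\<sigma> :: real) (\<delta> :: real).
       1 \<le> d \<and> d \<le> n \<and> x \<in> carrier_vec d \<and> 0 < \<sigma> \<and> 0 < \<delta> \<and> \<delta> < 2 \<and>
       2 + ln (1 + (x \<bullet> x) / \<sigma>\<^sup>2) \<le> (2 - \<delta>) * ln (real n)
       \<longrightarrow> (\<forall>Phat \<in> estimators n d. \<exists>P \<in> perm_mats n.
              error_prob n d \<sigma> x P Phat \<ge> 1 - c3 * exp (- c4 * real n * \<delta>)))"
proof (intro exI conjI allI impI ballI)
  fix n d :: nat and x :: "real vec" and \<sigma> \<delta> :: real and Phat
  assume "1 \<le> d \<and> d \<le> n \<and> x \<in> carrier_vec d \<and> 0 < \<sigma> \<and> 0 < \<delta> \<and> \<delta> < 2 \<and>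
       2 + ln (1 + (x \<bullet> x) / \<sigma>\<^sup>2) \<le> (2 - \<delta>) * ln (real n)"
    and Phat: "Phat \<in> estimators n d"
  then have d: "1 \<le> d" and n: "0 < n" and x: "x \<in> carrier_vec d" and \<sigma>: "0 < \<sigma>" and \<delta>: "0 < \<delta>" "\<delta> < 2"
    and snr: "2 + ln (1 + (x \<bullet> x) / \<sigma>\<^sup>2) \<le> (2 - \<delta>) * ln (real n)" by auto
  let ?M = "gaussian_mat n d \<Otimes>\<^sub>M gaussian_vec n \<sigma>"
  let ?S = "\<lambda>\<pi>. success_event n d \<sigma> x (perm_mat n \<pi>) Phat"
  let ?Pi = "{\<pi>. \<pi> permutes {..<n}}"
  let ?b = "exp (1/250 - real n / 100000) + exp (- real n / 5000)"
  interpret GM: prob_space "gaussian_mat n d" by (rule prob_space_gaussian_mat)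
  interpret GV: prob_space "gaussian_vec n \<sigma>" by (rule prob_space_gaussian_vec[OF \<sigma>])
  interpret GP: pair_prob_space "gaussian_mat n d" "gaussian_vec n \<sigma>" ..
  have xx: "0 \<le> x \<bullet> x" by (simp add: scalar_prod_self_eq_sum[OF x] sum_nonneg)
  \<comment> \<open>Dropping this term and exponentiating yields
    \<open>exp 2 * (1 + |x|^2 / \<sigma>^2)\<close> \<le> \<open>n^2\<close>; the square root of the
    part with \<open>|x|^2\<close> is \<open>snr'\<close>.\<close>
  have "0 \<le> \<delta> * ln (real n)" using \<delta> n by (intro mult_nonneg_nonneg) auto
  with snr have "2 + ln (1 + (x \<bullet> x) / \<sigma>\<^sup>2) \<le> 2 * ln (real n)"
    by (simp only: left_diff_distrib)
  then have "exp (2 + ln (1 + (x \<bullet> x) / \<sigma>\<^sup>2)) \<le> exp (2 * ln (real n))" by simp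
  moreover have "exp (2 + ln (1 + (x \<bullet> x) / \<sigma>\<^sup>2)) = (exp 1)\<^sup>2 * (1 + (x \<bullet> x) / \<sigma>\<^sup>2)"
    using xx \<sigma> by (simp add: exp_add add_pos_nonneg flip: exp_of_nat_mult)
  moreover have "exp (2 * ln (real n)) = (real n)\<^sup>2"
    using n by (simp add: exp_double)
  ultimately have "(exp 1)\<^sup>2 * (1 + (x \<bullet> x) / \<sigma>\<^sup>2) \<le> (real n)\<^sup>2" by simp
  moreover have "(exp 1)\<^sup>2 * ((x \<bullet> x) / \<sigma>\<^sup>2) \<le> (exp 1)\<^sup>2 * (1 + (x \<bullet> x) / \<sigma>\<^sup>2)"
    by (intro mult_left_mono) auto
  ultimately have "(exp 1)\<^sup>2 * ((x \<bullet> x) / \<sigma>\<^sup>2) \<le> (real n)\<^sup>2" by linarith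
  then have "(sqrt (x \<bullet> x) * exp 1)\<^sup>2 \<le> (\<sigma> * real n)\<^sup>2"
    using \<sigma> xx by (simp add: power_mult_distrib field_simps)
  then have snr': "sqrt (x \<bullet> x) * exp 1 \<le> \<sigma> * real n"
    by (rule power2_le_imp_le) (use \<sigma> in simp)
  have sum_le: "(\<Sum>\<pi>\<in>?Pi. measure ?M (?S \<pi>)) \<le> fact n * ?b"
    by (rule sum_success_le[OF \<sigma> n d x snr' Phat])
  have "\<exists>\<pi>\<in>?Pi. measure ?M (?S \<pi>) \<le> ?b"
  proof (rule ccontr)
    assume "\<not> ?thesis"
    moreover have "?Pi \<noteq> {}" using permutes_id by blast
    ultimately have "(\<Sum>\<pi>\<in>?Pi. ?b) < (\<Sum>\<pi>\<in>?Pi. measure ?M (?S \<pi>))"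
      by (intro sum_strict_mono) (simp_all add: finite_permutations not_le)
    with sum_le show False by (simp add: card_permutations)
  qed
  then obtain \<pi> where \<pi>: "\<pi> permutes {..<n}" and le: "measure ?M (?S \<pi>) \<le> ?b" by auto
  have P: "perm_mat n \<pi> \<in> perm_mats n" by (rule perm_mat_in_perm_mats[OF \<pi>])
  have "measure ?M (?S \<pi>) = 1 - error_prob n d \<sigma> x (perm_mat n \<pi>) Phat"
    unfolding success_event_def error_prob_def by (rule GP.prob_compl[OF error_event_measurable[OF x P Phat]])
  \<comment> \<open>As \<open>\<delta> < 2\<close>, \<open>n/100000\<close> is at least
    \<open>n \<delta> / 200000\<close>. The first term of \<open>?b\<close> contributes a factor at
    most \<open>exp 1\<close> \<le> 3 and the Hoeffding term a factor 1, which makes 4.\<close>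
  moreover have "?b \<le> 4 * exp (- (1/200000) * real n * \<delta>)"
  proof -
    have \<delta>n: "real n * \<delta> \<le> real n * 2" using \<delta> by (intro mult_left_mono) auto
    have "exp (1/250 - real n / 100000) \<le> exp (1 + - (1/200000) * real n * \<delta>)"
      using \<delta>n by simp
    also have "\<dots> = exp 1 * exp (- (1/200000) * real n * \<delta>)" by (rule exp_add)
    also have "\<dots> \<le> 3 * exp (- (1/200000) * real n * \<delta>)"
      using exp_le by (intro mult_right_mono) auto
    finally have "exp (1/250 - real n / 100000) \<le> 3 * exp (- (1/200000) * real n * \<delta>)" .
    moreover have "exp (- real n / 5000) \<le> exp (- (1/200000) * real n * \<delta>)"
      using \<delta>n unfolding exp_le_cancel_iff by (simp add: mult.commute[of \<delta>])
    ultimately show ?thesis by linarith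
  qed
  ultimately have "1 - 4 * exp (- (1/200000) * real n * \<delta>) \<le> error_prob n d \<sigma> x (perm_mat n \<pi>) Phat"
    using le by linarith
  with P show "\<exists>P\<in>perm_mats n. 1 - 4 * exp (- (1/200000) * real n * \<delta>) \<le> error_prob n d \<sigma> x P Phat" ..
qed simp_all

end
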